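(* Let $S = k[x_1,\ldots,x_r]$ be a polynomial ring in $r$ variables over a field $k$ and let $\mathfrak m=(x_1,\ldots,x_r)$ be the maximal homogeneous ideal of $S$. Let $P_1,\ldots,P_\alpha$, with $\alpha \geq 2$, be distinct ideals of $S$, each generated by a subset of $\{x_1,\ldots,x_r\}$. Let $I = \bigcap_{i=1}^\alpha P_i$, $R=S/I$, let $\mathfrak n = \mathfrak m/I$ be the maximal homogeneous ideal of $R$, and let $d=\dim(R)$. Set $\delta = \max\{\, |a_i(R)| : a_i(R) \neq -\infty \,\}$. Then for integers $s > \delta$, the length $$\ell\left(\frac{\mathcal R(\mathfrak n)}{(\mathfrak n,\mathfrak n t)^{[s]}}\right)$$ is a polynomial in $s$; that is, there is a polynomial $P(X)\in\mathbb{Q}[X]$ such that this length equals $P(s)$ for all integers $s>\delta$.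
   Context: $\mathcal R(\mathfrak n)=\bigoplus_{n\ge 0}\mathfrak n^n t^n\subseteq R[t]$ is the Rees algebra of $\mathfrak n$, and $(\mathfrak n,\mathfrak n t)$ is its maximal homogeneous ideal. For an ideal $J=(a_1,\ldots,a_g)$ with a fixed set of generators, the $s$-th (generalized) Frobenius power is $J^{[s]}=(a_1^s,\ldots,a_g^s)$. Here $\mathfrak n$ is generated by the images of $x_1,\ldots,x_r$ in $R$, and $(\mathfrak n,\mathfrak n t)$ is generated by the images of $x_1,\ldots,x_r$ together with $x_1t,\ldots,x_rt$, so $(\mathfrak n,\mathfrak n t)^{[s]}$ is the ideal of $\mathcal R(\mathfrak n)$ generated by $x_1^s,\ldots,x_r^s,x_1^st^s,\ldots,x_r^st^s$. The function $s\mapsto \ell(\mathcal R(\mathfrak n)/(\mathfrak n,\mathfrak n t)^{[s]})$ is called the generalized Hilbert-Kunz function of $(\mathfrak n,\mathfrak n t)$; $\ell$ denotes length. $R$ carries the standard grading with $\deg x_i=1$, and $a_i(R)=\max\{u\in\mathbb Z : [H^i_{\mathfrak n}(R)]_u\neq 0\}$ if the graded local cohomology module $H^i_{\mathfrak n}(R)$ is nonzero, and $a_i(R)=-\infty$ otherwise. *)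

theory Defs
  imports
    "HOL-Algebra.Algebra"
    "HOL-Computational_Algebra.Polynomial"
    "HOL-Library.Poly_Mapping"
    "HOL-Library.Extended"
    "HOL-Library.Extended_Nat"
begin

section \<open>The polynomial ring\<close>

text \<open>A monomial is its exponent vector, a finitely supported map of type
  \<^typ>\<open>nat \<Rightarrow>\<^sub>0 nat\<close>, and a polynomial is a finitely supported map from monomials to
  coefficients. The variables are indexed by 1, ..., r.\<close>

type_synonym 'k mpoly = "(nat \<Rightarrow>\<^sub>0 nat) \<Rightarrow>\<^sub>0 'k"

definition mpoly_ring :: "nat \<Rightarrow> 'k::field mpoly ring" where
  "mpoly_ring r = \<lparr>carrier = {p. \<forall>m\<in>Poly_Mapping.keys p. Poly_Mapping.keys m \<subseteq> {1..r}},
     monoid.mult = (*), monoid.one = 1, ring.zero = 0, ring.add = (+)\<rparr>"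

definition Var :: "nat \<Rightarrow> 'k::field mpoly" where
  "Var i = Poly_Mapping.single (Poly_Mapping.single i 1) 1"

definition total_degree :: "(nat \<Rightarrow>\<^sub>0 nat) \<Rightarrow> nat" where
  "total_degree m = (\<Sum>i\<in>Poly_Mapping.keys m. Poly_Mapping.lookup m i)"

definition homogeneous_part :: "nat \<Rightarrow> int \<Rightarrow> 'k::field mpoly set" where
  "homogeneous_part r v =
     {p \<in> carrier (mpoly_ring r). \<forall>m\<in>Poly_Mapping.keys p. int (total_degree m) = v}"

text \<open>The grading that a homogeneous ideal \<open>I\<close> induces on the quotient by \<open>I\<close>.\<close>

definition quot_grading :: "nat \<Rightarrow> 'k::field mpoly set \<Rightarrow> int \<Rightarrow> 'k mpoly set set" where
  "quot_grading r I v = (\<lambda>p. I +>\<^bsub>mpoly_ring r\<^esub> p) ` homogeneous_part r v"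


section \<open>Dimension and length\<close>

definition max_chain_length :: "('a set \<Rightarrow> bool) \<Rightarrow> enat" where
  "max_chain_length Q = Sup {enat n | n.
     \<exists>C :: nat \<Rightarrow> 'a set. (\<forall>i\<le>n. Q (C i)) \<and> (\<forall>i<n. C i \<subset> C (Suc i))}"

definition krull_dim :: "('a, 'm) ring_scheme \<Rightarrow> enat" where
  "krull_dim R = max_chain_length (\<lambda>p. primeideal p R)"

definition module_length ::
    "('a, 'm) ring_scheme \<Rightarrow> ('a, 'b, 'n) module_scheme \<Rightarrow> enat" where
  "module_length A M = max_chain_length (\<lambda>N. submodule N A M)"

definition quot_module :: "('a, 'm) ring_scheme \<Rightarrow> 'a set \<Rightarrow> ('a, 'a set) module" where
  "quot_module A J = ring.extend (A Quot J)
     \<lparr>module.smult = (\<lambda>a \<xi>. (J +>\<^bsub>A\<^esub> a) \<otimes>\<^bsub>A Quot J\<^esub> \<xi>)\<rparr>"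


section \<open>Rees algebra and Frobenius powers\<close>

definition rees_algebra :: "('a, 'm) ring_scheme \<Rightarrow> 'a set \<Rightarrow> ('a, nat \<Rightarrow> 'a) up_ring" where
  "rees_algebra R I = (UP R)\<lparr>carrier :=
     {p \<in> carrier (UP R). \<forall>n. up_ring.coeff (UP R) p n \<in> I [^]\<^bsub>ideals_set R\<^esub> n}\<rparr>"

text \<open>The second argument is the chosen generating set of the ideal; the power depends
  on it.\<close>

definition frobenius_power :: "('a, 'm) ring_scheme \<Rightarrow> 'a set \<Rightarrow> nat \<Rightarrow> 'a set" where
  "frobenius_power A G s = genideal A ((\<lambda>g. g [^]\<^bsub>A\<^esub> s) ` G)"


section \<open>Localization at an element\<close>

text \<open>The pair \<open>(a, n)\<close> stands for the fraction with numerator \<open>a\<close> and denominator the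
  \<open>n\<close>-th power of \<open>f\<close>.\<close>

definition frac_rel :: "('a, 'm) ring_scheme \<Rightarrow> 'a \<Rightarrow> (('a \<times> nat) \<times> ('a \<times> nat)) set" where
  "frac_rel R f = {((a, n), (b, m)). a \<in> carrier R \<and> b \<in> carrier R \<and>
     (\<exists>l::nat. f [^]\<^bsub>R\<^esub> l \<otimes>\<^bsub>R\<^esub> (f [^]\<^bsub>R\<^esub> m \<otimes>\<^bsub>R\<^esub> a) =
               f [^]\<^bsub>R\<^esub> l \<otimes>\<^bsub>R\<^esub> (f [^]\<^bsub>R\<^esub> n \<otimes>\<^bsub>R\<^esub> b))}"

definition loc_frac :: "('a, 'm) ring_scheme \<Rightarrow> 'a \<Rightarrow> 'a \<Rightarrow> nat \<Rightarrow> ('a \<times> nat) set" where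
  "loc_frac R f a n = frac_rel R f `` {(a, n)}"

text \<open>The unions below are unions of equal classes: the operations do not depend on the
  representatives.\<close>

definition localization :: "('a, 'm) ring_scheme \<Rightarrow> 'a \<Rightarrow> ('a \<times> nat) set ring" where
  "localization R f = \<lparr>carrier = (carrier R \<times> UNIV) // frac_rel R f,
     monoid.mult = (\<lambda>\<xi> \<eta>. \<Union>(a, n)\<in>\<xi>. \<Union>(b, m)\<in>\<eta>. loc_frac R f (a \<otimes>\<^bsub>R\<^esub> b) (n + m)),
     monoid.one = loc_frac R f \<one>\<^bsub>R\<^esub> 0,
     ring.zero = loc_frac R f \<zero>\<^bsub>R\<^esub> 0,
     ring.add = (\<lambda>\<xi> \<eta>. \<Union>(a, n)\<in>\<xi>. \<Union>(b, m)\<in>\<eta>.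
              loc_frac R f (f [^]\<^bsub>R\<^esub> m \<otimes>\<^bsub>R\<^esub> a \<oplus>\<^bsub>R\<^esub> f [^]\<^bsub>R\<^esub> n \<otimes>\<^bsub>R\<^esub> b) (n + m))\<rparr>"

text \<open>The canonical map from the localization at \<open>f\<close> to the localization at \<open>f g\<close>.\<close>

definition loc_map ::
    "('a, 'm) ring_scheme \<Rightarrow> 'a \<Rightarrow> 'a \<Rightarrow> ('a \<times> nat) set \<Rightarrow> ('a \<times> nat) set" where
  "loc_map R f g \<xi> = (\<Union>(a, n)\<in>\<xi>. loc_frac R (f \<otimes>\<^bsub>R\<^esub> g) (a \<otimes>\<^bsub>R\<^esub> g [^]\<^bsub>R\<^esub> n) n)"

text \<open>The degree \<open>u\<close> part of the localization of a ring with homogeneous components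
  \<open>Rg v\<close>, where \<open>f\<close> is homogeneous of degree \<open>e\<close>.\<close>

definition loc_part ::
    "('a, 'm) ring_scheme \<Rightarrow> (int \<Rightarrow> 'a set) \<Rightarrow> 'a \<Rightarrow> nat \<Rightarrow> int \<Rightarrow> ('a \<times> nat) set set" where
  "loc_part R Rg f e u = {loc_frac R f a n | a n. a \<in> Rg (u + int n * int e)}"


section \<open>Graded local cohomology and a-invariants\<close>

text \<open>Local cohomology with support in the ideal generated by \<open>x 1, ..., x r\<close> is the
  cohomology of the Cech complex of \<open>R\<close> with respect to these elements. Its term in
  cohomological degree \<open>i\<close> is the direct sum of the localizations of \<open>R\<close> at the products
  of \<open>x j\<close> for \<open>j \<in> F\<close>, over all \<open>i\<close>-element subsets \<open>F\<close> of \<open>{1..r}\<close>. The \<open>x j\<close> are taken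
  to be homogeneous of degree 1.\<close>

definition cech_index :: "nat \<Rightarrow> nat \<Rightarrow> nat set set" where
  "cech_index r i = {F. F \<subseteq> {1..r} \<and> card F = i}"

definition cech_elem :: "('a, 'm) ring_scheme \<Rightarrow> (nat \<Rightarrow> 'a) \<Rightarrow> nat set \<Rightarrow> 'a" where
  "cech_elem R x F = (\<Otimes>\<^bsub>R\<^esub>j\<in>F. x j)"

definition cech_part ::
    "('a, 'm) ring_scheme \<Rightarrow> (int \<Rightarrow> 'a set) \<Rightarrow> (nat \<Rightarrow> 'a) \<Rightarrow> nat \<Rightarrow> nat \<Rightarrow> int \<Rightarrow>
      (nat set \<Rightarrow> ('a \<times> nat) set) set" where
  "cech_part R Rg x r i u = (\<Pi>\<^sub>E F\<in>cech_index r i. loc_part R Rg (cech_elem R x F) i u)"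

definition cech_zero ::
    "('a, 'm) ring_scheme \<Rightarrow> (nat \<Rightarrow> 'a) \<Rightarrow> nat \<Rightarrow> nat \<Rightarrow> nat set \<Rightarrow> ('a \<times> nat) set" where
  "cech_zero R x r i = (\<lambda>F\<in>cech_index r i. \<zero>\<^bsub>localization R (cech_elem R x F)\<^esub>)"

definition cech_diff ::
    "('a, 'm) ring_scheme \<Rightarrow> (nat \<Rightarrow> 'a) \<Rightarrow> nat \<Rightarrow> nat \<Rightarrow>
      (nat set \<Rightarrow> ('a \<times> nat) set) \<Rightarrow> nat set \<Rightarrow> ('a \<times> nat) set" where
  "cech_diff R x r i c = (\<lambda>F\<in>cech_index r (Suc i).
     let L = localization R (cech_elem R x F) in
     \<Oplus>\<^bsub>L\<^esub>j\<in>F. (let y = loc_map R (cech_elem R x (F - {j})) (x j) (c (F - {j}))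
               in if even (card {l \<in> F. l < j}) then y else \<ominus>\<^bsub>L\<^esub> y))"

definition cech_cocycles ::
    "('a, 'm) ring_scheme \<Rightarrow> (int \<Rightarrow> 'a set) \<Rightarrow> (nat \<Rightarrow> 'a) \<Rightarrow> nat \<Rightarrow> nat \<Rightarrow> int \<Rightarrow>
      (nat set \<Rightarrow> ('a \<times> nat) set) set" where
  "cech_cocycles R Rg x r i u =
     {c \<in> cech_part R Rg x r i u. cech_diff R x r i c = cech_zero R x r (Suc i)}"

definition cech_coboundaries ::
    "('a, 'm) ring_scheme \<Rightarrow> (int \<Rightarrow> 'a set) \<Rightarrow> (nat \<Rightarrow> 'a) \<Rightarrow> nat \<Rightarrow> nat \<Rightarrow> int \<Rightarrow>
      (nat set \<Rightarrow> ('a \<times> nat) set) set" where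
  "cech_coboundaries R Rg x r i u =
     (case i of 0 \<Rightarrow> {cech_zero R x r 0}
      | Suc j \<Rightarrow> cech_diff R x r j ` cech_part R Rg x r j u)"

text \<open>The degree \<open>u\<close> part of the \<open>i\<close>-th local cohomology, as an abelian group (written
  multiplicatively, as required by \<^const>\<open>FactGroup\<close>).\<close>

definition local_cohomology_part ::
    "('a, 'm) ring_scheme \<Rightarrow> (int \<Rightarrow> 'a set) \<Rightarrow> (nat \<Rightarrow> 'a) \<Rightarrow> nat \<Rightarrow> nat \<Rightarrow> int \<Rightarrow>
      (nat set \<Rightarrow> ('a \<times> nat) set) set monoid" where
  "local_cohomology_part R Rg x r i u =
     \<lparr>carrier = cech_cocycles R Rg x r i u,
      monoid.mult = (\<lambda>c c'. \<lambda>F\<in>cech_index r i.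
        c F \<oplus>\<^bsub>localization R (cech_elem R x F)\<^esub> c' F),
      monoid.one = cech_zero R x r i\<rparr> Mod cech_coboundaries R Rg x r i u"

definition local_cohomology_nonzero_at ::
    "('a, 'm) ring_scheme \<Rightarrow> (int \<Rightarrow> 'a set) \<Rightarrow> (nat \<Rightarrow> 'a) \<Rightarrow> nat \<Rightarrow> nat \<Rightarrow> int \<Rightarrow> bool" where
  "local_cohomology_nonzero_at R Rg x r i u \<longleftrightarrow>
     carrier (local_cohomology_part R Rg x r i u) \<noteq> {\<one>\<^bsub>local_cohomology_part R Rg x r i u\<^esub>}"

definition a_invariant ::
    "('a, 'm) ring_scheme \<Rightarrow> (int \<Rightarrow> 'a set) \<Rightarrow> (nat \<Rightarrow> 'a) \<Rightarrow> nat \<Rightarrow> nat \<Rightarrow> int extended" where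
  "a_invariant R Rg x r i =
     (if \<exists>u. local_cohomology_nonzero_at R Rg x r i u
      then Fin (GREATEST u. local_cohomology_nonzero_at R Rg x r i u) else Minf)"

end

theory Submission
  imports Defs "HOL-Library.Product_Plus"
begin

text \<open>Everything in sight has a basis of monomials over \<open>k\<close>. Each \<open>P i\<close> is spanned by the monomials
  divisible by one of its variables, hence \<open>I\<close> is spanned by the monomials whose support meets every
  generating set, and \<open>R\<close> has as basis the monomials \<open>x\<^sup>m\<close> whose support is a face of the simplicial
  complex of all \<open>F \<subseteq> {1..r}\<close> that are disjoint from some generating set. The \<open>n\<close>-th power of the maximal
  ideal is spanned by the monomials of degree at least \<open>n\<close>, so the Rees algebra has the basis
  \<open>x\<^sup>m t\<^sup>n\<close> with \<open>n \<le> |m|\<close>, and the Frobenius power is spanned by the multiples of the monomials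
  \<open>x\<^sub>i\<^sup>s\<close> and \<open>x\<^sub>i\<^sup>s t\<^sup>s\<close>.

  The length of a quotient by an ideal spanned by monomials is the number of basis monomials that
  survive (\<open>module_length_quot_mono_ideal\<close>): leading coefficients bound the length of a chain of
  submodules from above, and ordering the monomials by degree gives a chain that attains the bound.

  The survivors are counted one face \<open>F\<close> at a time. A monomial \<open>x\<^sup>m t\<^sup>n\<close> with support \<open>F\<close> survives iff
  either all exponents \<open>m\<^sub>i\<close> are smaller than \<open>s\<close>, or some \<open>m\<^sub>i \<ge> s\<close> and \<open>|m| - s < n < s\<close>. The first
  kind contributes the sum of \<open>|m| + 1\<close> over the cube \<open>1 \<le> m\<^sub>i < s\<close>. In the second kind the large
  exponent is unique, because two of them would force \<open>|m| \<ge> 2s\<close>; replacing \<open>m\<^sub>i\<close> by \<open>m\<^sub>i - (s - 1)\<close>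
  and recording \<open>s - n\<close> as the exponent of one extra variable turns these pairs into the monomials of
  degree at most \<open>s\<close> whose support is \<open>F\<close> together with that variable, and there are
  \<open>s choose (f + 1)\<close> of them, where \<open>f\<close> is the size of \<open>F\<close>. So for all \<open>s \<ge> 1\<close> the face \<open>F\<close> contributes
  \<open>(s - 1)\<^sup>f + f s (s - 1)\<^sup>f / 2 + f (s choose (f + 1))\<close> (\<open>card_survivors\<close>), a polynomial in \<open>s\<close>, and the
  length is the sum of these polynomials over all faces.\<close>

section \<open>Exponent vectors\<close>

abbreviation "keys \<equiv> Poly_Mapping.keys"
abbreviation "lookup \<equiv> Poly_Mapping.lookup"
abbreviation "single \<equiv> Poly_Mapping.single"

lemma keys_add_nat: "keys (m + m' :: nat \<Rightarrow>\<^sub>0 nat) = keys m \<union> keys m'"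
  by (auto simp: in_keys_iff lookup_add)

lemma keys_diff_nat: "keys (m - m' :: nat \<Rightarrow>\<^sub>0 nat) \<subseteq> keys m"
  by (auto simp: in_keys_iff lookup_minus)

lemma total_degree_eq_sum:
  assumes "finite D" "keys m \<subseteq> D"
  shows "total_degree m = (\<Sum>i\<in>D. lookup m i)"
  unfolding total_degree_def using assms
  by (intro sum.mono_neutral_left) (auto simp: in_keys_iff)

lemma total_degree_add: "total_degree (m + m') = total_degree m + total_degree m'"
proof -
  have "total_degree (m + m') = (\<Sum>i\<in>keys m \<union> keys m'. lookup m i + lookup m' i)"
    by (subst total_degree_eq_sum[of "keys m \<union> keys m'"]) (auto simp: keys_add_nat lookup_add)
  then show ?thesis
    by (simp add: sum.distrib total_degree_eq_sum[of "keys m \<union> keys m'" m]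
        total_degree_eq_sum[of "keys m \<union> keys m'" m'])
qed

lemma total_degree_single [simp]: "total_degree (single i n) = n"
  by (simp add: total_degree_def)

lemma total_degree_zero [simp]: "total_degree 0 = 0"
  by (simp add: total_degree_def)

lemma total_degree_eq_0_iff: "total_degree m = 0 \<longleftrightarrow> m = 0"
  by (auto simp: total_degree_def in_keys_iff intro!: poly_mapping_eqI)

lemma diff_single_add:
  assumes "n \<le> lookup m i"
  shows "(m - single i n) + single i n = (m :: nat \<Rightarrow>\<^sub>0 nat)"
  using assms by (intro poly_mapping_eqI) (auto simp: lookup_add lookup_minus lookup_single when_def)

lemma total_degree_diff_single:
  assumes "n \<le> lookup m i"
  shows "total_degree m = total_degree (m - single i n) + n"
  using diff_single_add[OF assms] total_degree_add[of "m - single i n" "single i n"] by simp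

lemma lookup_le_total_degree: "lookup m i \<le> total_degree m"
  using total_degree_diff_single[of "lookup m i" m i] by simp

lemma lookup_two_le_total_degree:
  assumes "i \<noteq> j"
  shows "lookup m i + lookup m j \<le> total_degree m"
proof -
  have "lookup m j \<le> total_degree (m - single i (lookup m i))"
    using lookup_le_total_degree[of "m - single i (lookup m i)" j] assms
    by (simp add: lookup_minus lookup_single_not_eq)
  then show ?thesis using total_degree_diff_single[of "lookup m i" m i] by simp
qed


section \<open>Commutative rings with a monomial basis\<close>

text \<open>A commutative ring with a \<open>k\<close>-basis of monomials: \<open>mon b c\<close> is \<open>c\<close> times the monomial with exponent
  \<open>b\<close>, and \<open>coef p b\<close> reads off a coefficient. A product of two monomials is the monomial with the sum
  of the exponents, or zero if that sum is not in the basis. Polynomial rings, their quotients by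
  ideals spanned by monomials and the Rees algebras of such quotients are all of this form, which is
  why the locale is kept abstract in the ring and in the type of exponents. The values of \<open>coef\<close> and
  \<open>mon\<close> at exponents outside \<open>B\<close> are arbitrary.\<close>

locale monomial_cring = cring A for A :: "('a, 'm) ring_scheme" (structure) +
  fixes B :: "'b::comm_monoid_add set"
    and coef :: "'a \<Rightarrow> 'b \<Rightarrow> 'k::field"
    and mon :: "'b \<Rightarrow> 'k \<Rightarrow> 'a"
  assumes mon_closed [simp, intro]: "b \<in> B \<Longrightarrow> mon b c \<in> carrier A"
    and coef_mon: "b \<in> B \<Longrightarrow> b' \<in> B \<Longrightarrow> coef (mon b c) b' = (if b' = b then c else 0)"
    and coef_add: "p \<in> carrier A \<Longrightarrow> q \<in> carrier A \<Longrightarrow> b \<in> B \<Longrightarrow>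
      coef (p \<oplus> q) b = coef p b + coef q b"
    and coef_inj: "p \<in> carrier A \<Longrightarrow> q \<in> carrier A \<Longrightarrow> (\<And>b. b \<in> B \<Longrightarrow> coef p b = coef q b) \<Longrightarrow> p = q"
    and coef_finite: "p \<in> carrier A \<Longrightarrow> finite {b \<in> B. coef p b \<noteq> 0}"
    and zero_in_basis [simp]: "0 \<in> B"
    and one_eq_mon: "\<one> = mon 0 1"
    and mon_mult: "b \<in> B \<Longrightarrow> b' \<in> B \<Longrightarrow>
      mon b c \<otimes> mon b' c' = (if b + b' \<in> B then mon (b + b') (c * c') else \<zero>)"
begin

lemma coef_zero [simp]: "b \<in> B \<Longrightarrow> coef \<zero> b = 0"
  using coef_add[of \<zero> \<zero> b] by (metis add_cancel_right_right l_zero zero_closed)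

lemma coef_uminus: "p \<in> carrier A \<Longrightarrow> b \<in> B \<Longrightarrow> coef (\<ominus> p) b = - coef p b"
  using coef_add[of p "\<ominus> p" b] by (simp add: r_neg add_eq_0_iff)

lemma coef_diff: "p \<in> carrier A \<Longrightarrow> q \<in> carrier A \<Longrightarrow> b \<in> B \<Longrightarrow> coef (p \<ominus> q) b = coef p b - coef q b"
  by (simp add: a_minus_def coef_add coef_uminus)

lemma coef_finsum:
  assumes "finite D" "f \<in> D \<rightarrow> carrier A" "b \<in> B"
  shows "coef (\<Oplus>i\<in>D. f i) b = (\<Sum>i\<in>D. coef (f i) b)"
  using assms(1,2)
proof (induction D)
  case (insert x D)
  then have "f \<in> D \<rightarrow> carrier A" "f x \<in> carrier A" by auto
  with insert show ?case using assms(3) by (simp add: coef_add finsum_closed)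
qed (simp add: assms(3))

text \<open>Associativity of the multiplication restricts the possible sets of exponents: \<open>(b b') b''\<close> is a
  nonzero monomial, so \<open>b' b''\<close> cannot vanish.\<close>

lemma basis_assoc:
  assumes "b \<in> B" "b' \<in> B" "b'' \<in> B" "b + b' \<in> B" "b + b' + b'' \<in> B"
  shows "b' + b'' \<in> B"
proof (rule ccontr)
  assume "b' + b'' \<notin> B"
  then have "mon b 1 \<otimes> (mon b' 1 \<otimes> mon b'' 1) = \<zero>"
    using assms by (simp add: mon_mult)
  moreover have "(mon b 1 \<otimes> mon b' 1) \<otimes> mon b'' 1 = mon (b + b' + b'') 1"
    using assms by (simp add: mon_mult)
  ultimately have "mon (b + b' + b'') 1 = \<zero>"
    using assms by (simp add: m_assoc)
  with coef_mon[OF assms(5,5), of 1] assms(5) show False by simp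
qed

text \<open>An element is a finite sum of its terms, so an additive property holds for it once it holds for
  the terms. The set \<open>T\<close> keeps track of the support.\<close>

lemma mon_induct [consumes 1, case_names support zero mon add]:
  assumes p: "p \<in> carrier A"
    and supp: "\<And>b. b \<in> B \<Longrightarrow> coef p b \<noteq> 0 \<Longrightarrow> b \<in> T"
    and zero: "Q \<zero>"
    and mon: "\<And>b c. b \<in> B \<Longrightarrow> b \<in> T \<Longrightarrow> Q (mon b c)"
    and add: "\<And>p q. p \<in> carrier A \<Longrightarrow> q \<in> carrier A \<Longrightarrow> Q p \<Longrightarrow> Q q \<Longrightarrow> Q (p \<oplus> q)"
  shows "Q p"
  using p supp
proof (induction "card {b \<in> B. coef p b \<noteq> 0}" arbitrary: p rule: less_induct)
  case less
  show ?case
  proof (cases "\<exists>b\<in>B. coef p b \<noteq> 0")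
    case False
    then have "p = \<zero>" using less.prems by (intro coef_inj) auto
    then show ?thesis using zero by simp
  next
    case True
    then obtain b where b: "b \<in> B" "coef p b \<noteq> 0" by blast
    define q where "q = p \<ominus> mon b (coef p b)"
    have q: "q \<in> carrier A" using b less.prems by (simp add: q_def)
    have cq: "coef q b' = (if b' = b then 0 else coef p b')" if "b' \<in> B" for b'
      using that b less.prems by (simp add: q_def coef_diff coef_mon)
    have "{b \<in> B. coef q b \<noteq> 0} \<subset> {b \<in> B. coef p b \<noteq> 0}"
    proof
      show "{b \<in> B. coef q b \<noteq> 0} \<subseteq> {b \<in> B. coef p b \<noteq> 0}"
        using cq by (auto split: if_splits)
      show "{b \<in> B. coef q b \<noteq> 0} \<noteq> {b \<in> B. coef p b \<noteq> 0}"
        using b cq[OF b(1)] by auto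
    qed
    then have "card {b \<in> B. coef q b \<noteq> 0} < card {b \<in> B. coef p b \<noteq> 0}"
      using coef_finite[OF less.prems(1)] by (rule psubset_card_mono[rotated])
    then have "Q q"
    proof (rule less.hyps[OF _ q])
      show "b' \<in> T" if "b' \<in> B" "coef q b' \<noteq> 0" for b'
        using that cq less.prems(2)[of b'] by (simp split: if_splits)
    qed
    moreover have "Q (mon b (coef p b))" using b less.prems mon by blast
    moreover have "q \<oplus> mon b (coef p b) = p"
      using b less.prems q by (intro coef_inj) (auto simp: coef_add cq coef_mon)
    ultimately show ?thesis using add[of q "mon b (coef p b)"] q b by simp
  qed
qed

text \<open>The span of the monomials in \<open>T\<close>; only \<open>B \<inter> T\<close> matters. It is an ideal as soon as \<open>T\<close> is
  \<open>absorbing\<close>, that is, closed under nonzero products with arbitrary monomials.\<close>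

definition mono_ideal :: "'b set \<Rightarrow> 'a set" where
  "mono_ideal T = {p \<in> carrier A. \<forall>b\<in>B. coef p b \<noteq> 0 \<longrightarrow> b \<in> T}"

definition absorbing :: "'b set \<Rightarrow> bool" where
  "absorbing T \<longleftrightarrow> (\<forall>b\<in>B \<inter> T. \<forall>b'\<in>B. b + b' \<in> B \<longrightarrow> b + b' \<in> T)"

lemma mono_ideal_carrier: "p \<in> mono_ideal T \<Longrightarrow> p \<in> carrier A"
  by (simp add: mono_ideal_def)

lemma mono_idealI:
  "p \<in> carrier A \<Longrightarrow> (\<And>b. b \<in> B \<Longrightarrow> coef p b \<noteq> 0 \<Longrightarrow> b \<in> T) \<Longrightarrow> p \<in> mono_ideal T"
  by (simp add: mono_ideal_def)

lemma coef_mono_ideal: "p \<in> mono_ideal T \<Longrightarrow> b \<in> B \<Longrightarrow> b \<notin> T \<Longrightarrow> coef p b = 0"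
  by (auto simp: mono_ideal_def)

lemma zero_mono_ideal [simp]: "\<zero> \<in> mono_ideal T"
  by (simp add: mono_ideal_def)

lemma mon_mono_ideal: "b \<in> B \<Longrightarrow> b \<in> T \<Longrightarrow> mon b c \<in> mono_ideal T"
  by (auto simp: mono_ideal_def coef_mon split: if_splits)

lemma add_mono_ideal: "p \<in> mono_ideal T \<Longrightarrow> q \<in> mono_ideal T \<Longrightarrow> p \<oplus> q \<in> mono_ideal T"
  by (auto simp: mono_ideal_def coef_add)

lemma mono_ideal_induct [consumes 1, case_names zero mon add]:
  assumes "p \<in> mono_ideal T" "Q \<zero>" "\<And>b c. b \<in> B \<Longrightarrow> b \<in> T \<Longrightarrow> Q (mon b c)"
    and "\<And>p q. p \<in> carrier A \<Longrightarrow> q \<in> carrier A \<Longrightarrow> Q p \<Longrightarrow> Q q \<Longrightarrow> Q (p \<oplus> q)"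
  shows "Q p"
  using assms by (intro mon_induct[of p T Q]) (auto simp: mono_ideal_def)

lemma mult_mono_ideal:
  assumes p: "p \<in> mono_ideal T" and q: "q \<in> mono_ideal U"
    and TUV: "\<And>b b'. b \<in> B \<Longrightarrow> b \<in> T \<Longrightarrow> b' \<in> B \<Longrightarrow> b' \<in> U \<Longrightarrow> b + b' \<in> B \<Longrightarrow> b + b' \<in> V"
  shows "p \<otimes> q \<in> mono_ideal V"
  using p
proof (induction rule: mono_ideal_induct)
  case zero
  show ?case using q by (simp add: mono_ideal_carrier)
next
  case (mon b c)
  show ?case using q
  proof (induction rule: mono_ideal_induct)
    case zero
    show ?case using mon by simp
  next
    case (mon b' c')
    then show ?case using \<open>b \<in> B\<close> \<open>b \<in> T\<close> TUV by (simp add: mon_mult mon_mono_ideal)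
  next
    case (add q q')
    then show ?case using mon by (simp add: r_distr add_mono_ideal)
  qed
next
  case (add p p')
  then show ?case using q by (simp add: l_distr add_mono_ideal mono_ideal_carrier)
qed

lemma ideal_mono_ideal:
  assumes "absorbing T"
  shows "ideal (mono_ideal T) A"
proof (rule idealI)
  show "ring A" by (rule ring_axioms)
  show "subgroup (mono_ideal T) (add_monoid A)"
  proof (rule add.subgroupI)
    show "mono_ideal T \<noteq> {}" using zero_mono_ideal by blast
    show "\<ominus> p \<in> mono_ideal T" if "p \<in> mono_ideal T" for p
      using that by (simp add: mono_ideal_def coef_uminus)
  qed (auto simp: add_mono_ideal intro: mono_ideal_carrier)
next
  fix p q assume pq: "p \<in> mono_ideal T" "q \<in> carrier A"
  then have "q \<in> mono_ideal UNIV" by (simp add: mono_ideal_def)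
  with pq show "p \<otimes> q \<in> mono_ideal T" 
    using assms by (intro mult_mono_ideal[where T = T and U = UNIV]) (auto simp: absorbing_def)
  with pq show "q \<otimes> p \<in> mono_ideal T" by (simp add: m_comm mono_ideal_carrier)
qed

text \<open>The span of the multiples of the given monomials is an ideal, and every term in it is a term times a
  generator. The generating set may also contain zero, to cover images of variables that vanish
  in a quotient.\<close>

lemma genideal_mon:
  assumes G: "G \<subseteq> B" and H: "(\<lambda>g. mon g 1) ` G \<subseteq> H" "H \<subseteq> insert \<zero> ((\<lambda>g. mon g 1) ` G)"
  shows "genideal A H = mono_ideal {b. \<exists>g\<in>G. \<exists>b'\<in>B. b = g + b'}" (is "_ = mono_ideal ?T")
    and "absorbing {b. \<exists>g\<in>G. \<exists>b'\<in>B. b = g + b'}"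
proof -
  show abs: "absorbing ?T"
    unfolding absorbing_def
  proof safe
    fix g b' b'' assume *: "g \<in> G" "b' \<in> B" "b'' \<in> B" "g + b' \<in> B" "g + b' + b'' \<in> B"
    then have "b' + b'' \<in> B" using basis_assoc[of g b' b''] G by blast
    then show "\<exists>h\<in>G. \<exists>c\<in>B. g + b' + b'' = h + c" using * by (metis add.assoc)
  qed
  have Hc: "H \<subseteq> carrier A" using G H(2) by blast
  have "\<exists>b'\<in>B. g = g + b'" for g by (intro bexI[of _ 0]) auto
  then have "H \<subseteq> mono_ideal ?T"
    using H(2) G mon_mono_ideal[of _ ?T 1] zero_mono_ideal[of ?T] by blast
  then have "genideal A H \<subseteq> mono_ideal ?T"
    by (rule genideal_minimal[OF ideal_mono_ideal[OF abs]])
  moreover have "p \<in> genideal A H" if "p \<in> mono_ideal ?T" for p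
    using that
  proof (induction rule: mono_ideal_induct)
    interpret J: ideal "genideal A H" A by (rule genideal_ideal[OF Hc])
    case zero
    show ?case by simp
  next
    interpret J: ideal "genideal A H" A by (rule genideal_ideal[OF Hc])
    case (mon b c)
    then obtain g b' where g: "g \<in> G" "b' \<in> B" "b = g + b'" by blast
    then have "mon g 1 \<in> genideal A H" using genideal_self[OF Hc] H by auto
    then have "mon g 1 \<otimes> mon b' c \<in> genideal A H" using g by (intro J.I_r_closed) auto
    then show ?case using g mon G by (auto simp: mon_mult)
  next
    interpret J: ideal "genideal A H" A by (rule genideal_ideal[OF Hc])
    case (add p q)
    then show ?case by (simp add: J.a_closed)
  qed
  ultimately show "genideal A H = mono_ideal ?T" by blast
qed

lemma ideal_prod_mono_ideal:
  "mono_ideal T \<cdot> mono_ideal U = mono_ideal {b. \<exists>t\<in>B \<inter> T. \<exists>u\<in>B \<inter> U. b = t + u}"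
  (is "_ = mono_ideal ?V")
proof (intro equalityI subsetI)
  fix p assume "p \<in> mono_ideal T \<cdot> mono_ideal U"
  then show "p \<in> mono_ideal ?V"
  proof induction
    case (prod i j)
    then show ?case by (rule mult_mono_ideal) blast
  qed (rule add_mono_ideal)
next
  fix p assume "p \<in> mono_ideal ?V"
  then show "p \<in> mono_ideal T \<cdot> mono_ideal U"
  proof (induction rule: mono_ideal_induct)
    case zero
    show ?case using ideal_prod.prod[of \<zero> "mono_ideal T" \<zero> "mono_ideal U" A] by simp
  next
    case (mon b c)
    then obtain t u where "t \<in> B \<inter> T" "u \<in> B \<inter> U" "b = t + u" by blast
    then show ?case
      using mon ideal_prod.prod[of "mon t c" "mono_ideal T" "mon u 1" "mono_ideal U" A]
      by (simp add: mon_mono_ideal mon_mult)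
  qed (rule ideal_prod.sum)
qed

lemma mono_ideal_cong: "B \<inter> T = B \<inter> U \<Longrightarrow> mono_ideal T = mono_ideal U"
  unfolding mono_ideal_def by blast

lemma mon_pow:
  assumes "f 0 = 0" "\<And>n. f (Suc n) = f n + f 1" "\<And>n. f n \<in> B"
  shows "mon (f 1) 1 [^] (n::nat) = mon (f n) 1"
proof (induction n)
  case (Suc n)
  have "f n + f 1 \<in> B" using assms(2)[of n] assms(3)[of "Suc n"] by metis
  then show ?case using Suc assms(2)[of n] assms(3)[of n] assms(3)[of 1] by (simp add: mon_mult)
qed (simp add: assms(1) one_eq_mon)

end

section \<open>Quotients by ideals spanned by monomials\<close>

context monomial_cring
begin

text \<open>Outside \<open>T\<close> the coefficients of an element depend only on its coset modulo \<open>mono_ideal T\<close>, so they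
  can be read off from any representative.\<close>

definition quot_coef :: "'a set \<Rightarrow> 'b \<Rightarrow> 'k" where
  "quot_coef \<xi> b = coef (SOME p. p \<in> \<xi>) b"

definition quot_mon :: "'b set \<Rightarrow> 'b \<Rightarrow> 'k \<Rightarrow> 'a set" where
  "quot_mon T b c = mono_ideal T +> mon b c"

context
  fixes T :: "'b set"
  assumes T: "absorbing T"
begin

interpretation K: ideal "mono_ideal T" A
  by (rule ideal_mono_ideal[OF T])

lemma quot_coef_coset:
  assumes "p \<in> carrier A" "b \<in> B - T"
  shows "quot_coef (mono_ideal T +> p) b = coef p b"
proof -
  have "p \<in> mono_ideal T +> p" using assms by (simp add: K.a_rcos_self)
  then have "(SOME q. q \<in> mono_ideal T +> p) \<in> mono_ideal T +> p" by (rule someI)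
  then obtain h where "h \<in> mono_ideal T" "(SOME q. q \<in> mono_ideal T +> p) = h \<oplus> p"
    unfolding a_r_coset_def' by blast
  then show ?thesis using assms by (simp add: quot_coef_def coef_add coef_mono_ideal)
qed

lemma quot_carrier: "carrier (A Quot mono_ideal T) = (+>) (mono_ideal T) ` carrier A"
  by (auto simp: FactRing_def A_RCOSETS_def')

lemma quot_coset_eq:
  assumes "p \<in> carrier A" "q \<in> carrier A" "\<And>b. b \<in> B - T \<Longrightarrow> coef p b = coef q b"
  shows "mono_ideal T +> p = mono_ideal T +> q"
proof -
  have "b \<in> T" if "b \<in> B" "coef (p \<ominus> q) b \<noteq> 0" for b
    using that assms(3)[of b] assms(1,2) by (cases "b \<in> T") (simp_all add: coef_diff)
  then have "p \<ominus> q \<in> mono_ideal T" using assms(1,2) by (intro mono_idealI) auto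
  then show ?thesis using quotient_eq_iff_same_a_r_cos[OF K.is_ideal assms(1,2)] by simp
qed

lemma quot_mon_outside:
  assumes "b \<in> B" "b \<in> T"
  shows "quot_mon T b c = \<zero>\<^bsub>A Quot mono_ideal T\<^esub>"
  using K.a_rcos_const[OF mon_mono_ideal[OF assms]] by (simp add: quot_mon_def FactRing_def)

text \<open>The monomials outside \<open>T\<close> are a basis of the quotient by \<open>mono_ideal T\<close>, so the locale is closed
  under such quotients.\<close>

lemma monomial_cring_quotient:
  assumes T0: "0 \<notin> T"
  shows "monomial_cring (A Quot mono_ideal T) (B - T) quot_coef (quot_mon T)"
proof -
  interpret h: ring_hom_cring A "A Quot mono_ideal T" "(+>) (mono_ideal T)"
    by (rule K.rcos_ring_hom_cring[OF is_cring])
  have cQ: "\<exists>p\<in>carrier A. \<xi> = mono_ideal T +> p" if "\<xi> \<in> carrier (A Quot mono_ideal T)" for \<xi>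
    using that by (auto simp: quot_carrier)
  show ?thesis
  proof
    show "quot_mon T b c \<in> carrier (A Quot mono_ideal T)" if "b \<in> B - T" for b c
      using that by (simp add: quot_mon_def)
    show "quot_coef (quot_mon T b c) b' = (if b' = b then c else 0)"
      if "b \<in> B - T" "b' \<in> B - T" for b b' c
      using that by (simp add: quot_mon_def quot_coef_coset coef_mon)
    show "quot_coef (\<xi> \<oplus>\<^bsub>A Quot mono_ideal T\<^esub> \<eta>) b = quot_coef \<xi> b + quot_coef \<eta> b"
      if xy: "\<xi> \<in> carrier (A Quot mono_ideal T)" "\<eta> \<in> carrier (A Quot mono_ideal T)" "b \<in> B - T" for \<xi> \<eta> b
    proof -
      from xy obtain p q where "p \<in> carrier A" "\<xi> = mono_ideal T +> p" "q \<in> carrier A" "\<eta> = mono_ideal T +> q"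
        using cQ by meson
      then show ?thesis using xy(3) by (simp add: quot_coef_coset coef_add flip: h.hom_add)
    qed
    show "\<xi> = \<eta>" if xy: "\<xi> \<in> carrier (A Quot mono_ideal T)" "\<eta> \<in> carrier (A Quot mono_ideal T)"
      and eq: "\<And>b. b \<in> B - T \<Longrightarrow> quot_coef \<xi> b = quot_coef \<eta> b" for \<xi> \<eta>
    proof -
      from xy obtain p q where pq: "p \<in> carrier A" "\<xi> = mono_ideal T +> p" "q \<in> carrier A" "\<eta> = mono_ideal T +> q"
        using cQ by meson
      then have "coef p b = coef q b" if "b \<in> B - T" for b
        using eq[OF that] that by (simp add: quot_coef_coset)
      then show ?thesis using pq quot_coset_eq by blast
    qed
    show "finite {b \<in> B - T. quot_coef \<xi> b \<noteq> 0}" if \<xi>: "\<xi> \<in> carrier (A Quot mono_ideal T)" for \<xi>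
    proof -
      from \<xi> obtain p where p: "p \<in> carrier A" "\<xi> = mono_ideal T +> p" using cQ by meson
      then have "{b \<in> B - T. quot_coef \<xi> b \<noteq> 0} \<subseteq> {b \<in> B. coef p b \<noteq> 0}"
        by (auto simp: quot_coef_coset)
      then show ?thesis using coef_finite[OF p(1)] finite_subset by blast
    qed
    show "0 \<in> B - T" using T0 by simp
    show "\<one>\<^bsub>A Quot mono_ideal T\<^esub> = quot_mon T 0 1"
      using h.hom_one by (simp only: quot_mon_def one_eq_mon)
    show "quot_mon T b c \<otimes>\<^bsub>A Quot mono_ideal T\<^esub> quot_mon T b' c' =
        (if b + b' \<in> B - T then quot_mon T (b + b') (c * c') else \<zero>\<^bsub>A Quot mono_ideal T\<^esub>)"
      if b: "b \<in> B - T" "b' \<in> B - T" for b b' c c'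
    proof -
      have "quot_mon T b c \<otimes>\<^bsub>A Quot mono_ideal T\<^esub> quot_mon T b' c' = mono_ideal T +> (mon b c \<otimes> mon b' c')"
        using b by (simp add: quot_mon_def)
      also have "\<dots> = (if b + b' \<in> B - T then quot_mon T (b + b') (c * c') else \<zero>\<^bsub>A Quot mono_ideal T\<^esub>)"
        using b quot_mon_outside[of "b + b'"] h.hom_zero by (simp add: mon_mult quot_mon_def)
      finally show ?thesis .
    qed
  qed
qed

lemma image_mono_ideal_quotient:
  assumes T0: "0 \<notin> T" and TU: "B \<inter> T \<subseteq> U"
  shows "(+>) (mono_ideal T) ` mono_ideal U =
    monomial_cring.mono_ideal (A Quot mono_ideal T) (B - T) quot_coef U"
proof -
  interpret Q: monomial_cring "A Quot mono_ideal T" "B - T" quot_coef "quot_mon T"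
    by (rule monomial_cring_quotient[OF T0])
  show ?thesis
  proof (intro equalityI subsetI)
    fix \<xi> assume "\<xi> \<in> (+>) (mono_ideal T) ` mono_ideal U"
    then obtain p where p: "p \<in> mono_ideal U" "\<xi> = mono_ideal T +> p" by blast
    then have "p \<in> carrier A" by (simp add: mono_ideal_carrier)
    then show "\<xi> \<in> Q.mono_ideal U"
      using p quot_coef_coset coef_mono_ideal[OF p(1)]
      by (intro Q.mono_idealI) (auto simp: quot_carrier)
  next
    fix \<xi> assume \<xi>: "\<xi> \<in> Q.mono_ideal U"
    then obtain p where p: "p \<in> carrier A" "\<xi> = mono_ideal T +> p"
      using Q.mono_ideal_carrier quot_carrier by blast
    have "b \<in> U" if "b \<in> B" "coef p b \<noteq> 0" for b
    proof (cases "b \<in> T")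
      case False
      then have "quot_coef \<xi> b \<noteq> 0" using that p by (simp add: quot_coef_coset)
      then show ?thesis using Q.coef_mono_ideal[OF \<xi>, of b] that False by blast
    qed (use TU that in blast)
    then have "p \<in> mono_ideal U" using p by (intro mono_idealI)
    then show "\<xi> \<in> (+>) (mono_ideal T) ` mono_ideal U" using p by blast
  qed
qed

end

end



section \<open>Length as the number of basis monomials\<close>

text \<open>Coordinates \<open>\<phi> x 0, ..., \<phi> x (N - 1)\<close> over a field determine the length of a module to be \<open>N\<close> if
  they separate elements, every position carries the leading coefficient of some element, scalars act
  through the ring, and the subspaces of elements with \<open>k\<close> leading zeros are submodules.
  The upper bound attaches to a submodule \<open>U\<close> the set \<open>L U\<close> of positions of leading coefficients of its
  elements. Gaussian elimination shows that submodules \<open>U \<subseteq> V\<close> with \<open>L U = L V\<close> coincide, so \<open>L\<close> maps a strict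
  chain of submodules to a strict chain of subsets of \<open>{..<N}\<close>. The submodules of elements with many
  leading zeros form a chain of length \<open>N\<close>.\<close>

lemma module_length_eq_number_of_coordinates:
  fixes A :: "('a, 'm) ring_scheme" and M :: "('a, 'b, 'n) module_scheme"
    and \<phi> :: "'b \<Rightarrow> nat \<Rightarrow> 'k::field"
  assumes M: "abelian_group M"
    and smult: "\<And>a x. a \<in> carrier A \<Longrightarrow> x \<in> carrier M \<Longrightarrow> a \<odot>\<^bsub>M\<^esub> x \<in> carrier M"
    and add: "\<And>x y i. x \<in> carrier M \<Longrightarrow> y \<in> carrier M \<Longrightarrow> i < N \<Longrightarrow> \<phi> (x \<oplus>\<^bsub>M\<^esub> y) i = \<phi> x i + \<phi> y i"
    and inj: "\<And>x y. x \<in> carrier M \<Longrightarrow> y \<in> carrier M \<Longrightarrow> (\<And>i. i < N \<Longrightarrow> \<phi> x i = \<phi> y i) \<Longrightarrow> x = y"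
    and scalar: "\<And>c. \<exists>a\<in>carrier A. \<forall>x\<in>carrier M. \<forall>i<N. \<phi> (a \<odot>\<^bsub>M\<^esub> x) i = c * \<phi> x i"
    and unit: "\<And>i. i < N \<Longrightarrow> \<exists>x\<in>carrier M. \<phi> x i \<noteq> 0 \<and> (\<forall>j<i. \<phi> x j = 0)"
    and flag: "\<And>a x k. a \<in> carrier A \<Longrightarrow> x \<in> carrier M \<Longrightarrow> k \<le> N \<Longrightarrow> (\<And>j. j < k \<Longrightarrow> \<phi> x j = 0) \<Longrightarrow>
      (\<And>j. j < k \<Longrightarrow> \<phi> (a \<odot>\<^bsub>M\<^esub> x) j = 0)"
  shows "module_length A M = enat N"
proof -
  interpret M: abelian_group M by (rule M)
  have zero: "\<phi> \<zero>\<^bsub>M\<^esub> i = 0" if "i < N" for i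
    using add[of "\<zero>\<^bsub>M\<^esub>" "\<zero>\<^bsub>M\<^esub>" i] that by (metis M.zero_closed M.l_zero add_cancel_right_right)
  have minus: "\<phi> (\<ominus>\<^bsub>M\<^esub> x) i = - \<phi> x i" if "x \<in> carrier M" "i < N" for x i
    using add[of x "\<ominus>\<^bsub>M\<^esub> x" i] that by (simp add: M.r_neg zero add_eq_0_iff)
  have sub: "U \<subseteq> carrier M" "\<zero>\<^bsub>M\<^esub> \<in> U" "\<And>x y. x \<in> U \<Longrightarrow> y \<in> U \<Longrightarrow> x \<oplus>\<^bsub>M\<^esub> y \<in> U"
    "\<And>x. x \<in> U \<Longrightarrow> \<ominus>\<^bsub>M\<^esub> x \<in> U" "\<And>a x. a \<in> carrier A \<Longrightarrow> x \<in> U \<Longrightarrow> a \<odot>\<^bsub>M\<^esub> x \<in> U"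
    if "submodule U A M" for U
  proof -
    interpret U: submodule U A M by (rule that)
    show "U \<subseteq> carrier M" "\<zero>\<^bsub>M\<^esub> \<in> U" "\<And>x y. x \<in> U \<Longrightarrow> y \<in> U \<Longrightarrow> x \<oplus>\<^bsub>M\<^esub> y \<in> U"
      "\<And>a x. a \<in> carrier A \<Longrightarrow> x \<in> U \<Longrightarrow> a \<odot>\<^bsub>M\<^esub> x \<in> U"
      using U.subset U.one_closed U.m_closed U.smult_closed by auto
    show "\<And>x. x \<in> U \<Longrightarrow> \<ominus>\<^bsub>M\<^esub> x \<in> U" using U.m_inv_closed by (simp add: a_inv_def)
  qed
  define L where "L U = {i. i < N \<and> (\<exists>x\<in>U. \<phi> x i \<noteq> 0 \<and> (\<forall>j<i. \<phi> x j = 0))}" for U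
  have L_mono: "L U \<subset> L V" if U: "submodule U A M" and V: "submodule V A M" and UV: "U \<subset> V" for U V
  proof -
    have "L U \<subseteq> L V" using UV unfolding L_def by blast
    moreover have "L U \<noteq> L V"
    proof
      assume eq: "L U = L V"
      \<comment> \<open>Induction on the number \<open>k\<close> of trailing coordinates that may be nonzero.\<close>
      have "x \<in> U" if "x \<in> V" "k \<le> N" "\<forall>j < N - k. \<phi> x j = 0" for x k
        using that
      proof (induction k arbitrary: x)
        case 0
        then have "x = \<zero>\<^bsub>M\<^esub>" using sub(1,2)[OF V] by (intro inj) (auto simp: zero)
        then show ?case using sub(2)[OF U] by simp
      next
        case (Suc k)
        define i where "i = N - Suc k"
        have i: "i < N" "N - k = Suc i" using Suc.prems by (auto simp: i_def)
        show ?case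
        proof (cases "\<phi> x i = 0")
          case True
          then have "\<forall>j < N - k. \<phi> x j = 0" using Suc.prems i by (auto simp: i_def less_Suc_eq)
          then show ?thesis using Suc by simp
        next
          case False
          then have "i \<in> L V" using Suc.prems i by (auto simp: L_def i_def)
          then have "i \<in> L U" using eq by simp
          then obtain y where y: "y \<in> U" "\<phi> y i \<noteq> 0" "\<forall>j<i. \<phi> y j = 0" unfolding L_def by blast
          obtain a where a: "a \<in> carrier A" "\<forall>z\<in>carrier M. \<forall>j<N. \<phi> (a \<odot>\<^bsub>M\<^esub> z) j = - (\<phi> x i / \<phi> y i) * \<phi> z j"
            using scalar by blast
          have c: "x \<in> carrier M" "y \<in> carrier M" using Suc.prems y sub(1)[OF U] sub(1)[OF V] by auto
          have ay: "a \<odot>\<^bsub>M\<^esub> y \<in> U" "a \<odot>\<^bsub>M\<^esub> y \<in> V" using sub(5)[OF U a(1) y(1)] UV by blast+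
          have ayc: "a \<odot>\<^bsub>M\<^esub> y \<in> carrier M" using a c smult by blast
          have "x \<oplus>\<^bsub>M\<^esub> a \<odot>\<^bsub>M\<^esub> y \<in> U"
          proof (rule Suc.IH)
            show "x \<oplus>\<^bsub>M\<^esub> a \<odot>\<^bsub>M\<^esub> y \<in> V" using Suc.prems ay sub(3)[OF V] by blast
            show "\<forall>j<N - k. \<phi> (x \<oplus>\<^bsub>M\<^esub> a \<odot>\<^bsub>M\<^esub> y) j = 0"
            proof (intro allI impI)
              fix j assume "j < N - k"
              then have j: "j < N" "j < i \<or> j = i" using i by auto
              then show "\<phi> (x \<oplus>\<^bsub>M\<^esub> a \<odot>\<^bsub>M\<^esub> y) j = 0"
                using Suc.prems c ayc a y by (auto simp: add i_def)
            qed
          qed (use Suc.prems in simp)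
          then have "(x \<oplus>\<^bsub>M\<^esub> a \<odot>\<^bsub>M\<^esub> y) \<oplus>\<^bsub>M\<^esub> \<ominus>\<^bsub>M\<^esub> (a \<odot>\<^bsub>M\<^esub> y) \<in> U"
            using sub(3,4)[OF U] ay by blast
          then show ?thesis using c ayc by (simp add: M.a_assoc M.r_neg)
        qed
      qed
      from this[of _ N] have "V \<subseteq> U" by auto
      then show False using UV by blast
    qed
    ultimately show ?thesis by blast
  qed
  have upper: "n \<le> N" if C: "\<forall>i\<le>n. submodule (C i) A M" "\<forall>i<n. C i \<subset> C (Suc i)" for n and C :: "nat \<Rightarrow> 'b set"
  proof -
    have fin: "finite (L U)" for U unfolding L_def by simp
    have "i \<le> card (L (C i))" if "i \<le> n" for i
      using that
    proof (induction i)
      case (Suc i)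
      then have "card (L (C i)) < card (L (C (Suc i)))"
        using C by (intro psubset_card_mono[OF fin] L_mono) auto
      then show ?case using Suc by simp
    qed simp
    then have "n \<le> card (L (C n))" by simp
    also have "\<dots> \<le> card {..<N}" by (rule card_mono) (auto simp: L_def)
    finally show ?thesis by simp
  qed
  define F where "F k = {x \<in> carrier M. \<forall>j < N - k. \<phi> x j = 0}" for k
  have "submodule (F k) A M" for k
  proof -
    have "subgroup (F k) (add_monoid M)"
    proof (rule M.add.subgroupI)
      show "F k \<noteq> {}" using zero by (auto simp: F_def intro!: exI[of _ "\<zero>\<^bsub>M\<^esub>"])
    qed (auto simp: F_def minus add)
    moreover have "a \<odot>\<^bsub>M\<^esub> x \<in> F k" if "a \<in> carrier A" "x \<in> F k" for a x
      using that smult flag[of a x "N - k"] by (auto simp: F_def)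
    ultimately show ?thesis by (simp add: submodule_def submodule_axioms_def)
  qed
  moreover have "F k \<subset> F (Suc k)" if "k < N" for k
  proof -
    have "N - Suc k < N" using that by simp
    then obtain x where x: "x \<in> carrier M" "\<phi> x (N - Suc k) \<noteq> 0" "\<forall>j < N - Suc k. \<phi> x j = 0"
      using unit[of "N - Suc k"] by blast
    moreover have "N - Suc k < N - k" using that by simp
    ultimately have "x \<in> F (Suc k)" "x \<notin> F k" unfolding F_def by blast+
    moreover have "F k \<subseteq> F (Suc k)" unfolding F_def by auto
    ultimately show ?thesis by blast
  qed
  ultimately have "enat N \<in> {enat n | n. \<exists>C :: nat \<Rightarrow> 'b set. (\<forall>i\<le>n. submodule (C i) A M) \<and> (\<forall>i<n. C i \<subset> C (Suc i))}"
    by blast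
  then show ?thesis
    unfolding module_length_def max_chain_length_def using upper
    by (intro cSup_eq_maximum) auto
qed

text \<open>The coordinates are the coefficients at the monomials outside \<open>T\<close>, listed by increasing degree. A
  product with a monomial other than 1 raises the degree, so multiplication by a ring element
  never creates a nonzero coefficient before the leading one. This is the compatibility with leading
  zeros that the previous lemma asks for.\<close>

lemma (in monomial_cring) module_length_quot_mono_ideal:
  fixes deg :: "'b \<Rightarrow> nat"
  assumes T: "absorbing T" and T0: "0 \<notin> T" and fin: "finite (B - T)"
    and deg_add: "\<And>b b'. b \<in> B \<Longrightarrow> b' \<in> B \<Longrightarrow> deg (b + b') = deg b + deg b'"
    and deg_0: "\<And>b. b \<in> B \<Longrightarrow> deg b = 0 \<Longrightarrow> b = 0"
  shows "module_length A (quot_module A (mono_ideal T)) = enat (card (B - T))"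
proof -
  define K where "K = mono_ideal T"
  interpret Q: monomial_cring "A Quot K" "B - T" quot_coef "quot_mon T"
    unfolding K_def by (rule monomial_cring_quotient[OF T T0])
  obtain cs where cs: "set cs = B - T" "distinct cs" using finite_distinct_list[OF fin] by blast
  define bs where "bs = sort_key deg cs"
  have bs: "set bs = B - T" "distinct bs" "sorted (map deg bs)" using cs by (simp_all add: bs_def)
  define N where "N = length bs"
  have N: "card (B - T) = N" using bs distinct_card N_def by metis
  have nth: "bs ! i \<in> B - T" if "i < N" for i using that bs(1) nth_mem N_def by metis
  have nth': "\<exists>i<N. b = bs ! i" if "b \<in> B - T" for b
    using that bs(1) by (metis in_set_conv_nth N_def)
  define M where "M = quot_module A K"
  have M: "carrier M = carrier (A Quot K)" "add M = add (A Quot K)"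
    "\<zero>\<^bsub>M\<^esub> = \<zero>\<^bsub>A Quot K\<^esub>" "\<And>a \<xi>. a \<odot>\<^bsub>M\<^esub> \<xi> = (K +> a) \<otimes>\<^bsub>A Quot K\<^esub> \<xi>"
    by (simp_all add: M_def quot_module_def ring.defs)
  have coset: "K +> a \<in> carrier (A Quot K)" if "a \<in> carrier A" for a
    using that quot_carrier[OF T] by (auto simp: K_def)
  define \<phi> where "\<phi> \<xi> i = quot_coef \<xi> (bs ! i)" for \<xi> i
  have "module_length A M = enat N"
  proof (rule module_length_eq_number_of_coordinates[where \<phi> = \<phi>])
    show "abelian_group M"
    proof (rule abelian_groupI)
      show "\<exists>y\<in>carrier M. y \<oplus>\<^bsub>M\<^esub> x = \<zero>\<^bsub>M\<^esub>" if "x \<in> carrier M" for x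
        using that by (intro bexI[of _ "\<ominus>\<^bsub>A Quot K\<^esub> x"]) (simp_all add: M Q.l_neg)
    qed (simp_all add: M Q.a_ac)
    show "a \<odot>\<^bsub>M\<^esub> x \<in> carrier M" if "a \<in> carrier A" "x \<in> carrier M" for a x
      using that coset by (simp add: M)
    show "\<phi> (x \<oplus>\<^bsub>M\<^esub> y) i = \<phi> x i + \<phi> y i" if "x \<in> carrier M" "y \<in> carrier M" "i < N" for x y i
      using that nth by (simp add: M \<phi>_def Q.coef_add)
    show "x = y" if "x \<in> carrier M" "y \<in> carrier M" "\<And>i. i < N \<Longrightarrow> \<phi> x i = \<phi> y i" for x y
      using that nth' by (intro Q.coef_inj) (auto simp: M \<phi>_def)
    show "\<exists>x\<in>carrier M. \<phi> x i \<noteq> 0 \<and> (\<forall>j<i. \<phi> x j = 0)" if "i < N" for i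
    proof (intro bexI[of _ "quot_mon T (bs ! i) 1"] conjI allI impI)
      show "\<phi> (quot_mon T (bs ! i) 1) i \<noteq> 0" using nth that by (simp add: \<phi>_def Q.coef_mon)
      show "\<phi> (quot_mon T (bs ! i) 1) j = 0" if "j < i" for j
        using nth that \<open>i < N\<close> bs(2) by (simp add: \<phi>_def Q.coef_mon nth_eq_iff_index_eq N_def)
      show "quot_mon T (bs ! i) 1 \<in> carrier M" using nth that by (simp add: M)
    qed
    show "\<phi> (a \<odot>\<^bsub>M\<^esub> x) j = 0"
      if ax: "a \<in> carrier A" "x \<in> carrier M" and k: "k \<le> N"
        and zero: "\<And>j. j < k \<Longrightarrow> \<phi> x j = 0" and j: "j < k" for a x k j
    proof -
      \<comment> \<open>The elements with \<open>k\<close> leading zeros are the span of the later monomials, an ideal.\<close>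
      define U where "U = {bs ! l | l. k \<le> l \<and> l < N}"
      have idx: "k \<le> l" if l: "bs ! l \<in> U" "l < N" for l
      proof -
        obtain l' where "bs ! l = bs ! l'" "k \<le> l'" "l' < N" using l U_def by auto
        then show ?thesis using bs(2) l by (simp add: nth_eq_iff_index_eq N_def)
      qed
      have "Q.absorbing U"
        unfolding Q.absorbing_def
      proof (intro ballI impI)
        fix b b' assume b: "b \<in> (B - T) \<inter> U" "b' \<in> B - T" "b + b' \<in> B - T"
        obtain l where l: "b = bs ! l" "k \<le> l" "l < N" using b U_def by auto
        obtain l' where l': "b + b' = bs ! l'" "l' < N" using b nth' by blast
        show "b + b' \<in> U"
        proof (cases "deg b' = 0")
          case True
          then show ?thesis using b deg_0[of b'] by simp
        next
          case False
          then have "deg (bs ! l) < deg (bs ! l')" using deg_add[of b b'] b l l' by simp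
          then have "l \<le> l'"
            using sorted_nth_mono[OF bs(3), of l' l] l l' by (fastforce simp: N_def)
          then show ?thesis using l l' by (auto simp: U_def)
        qed
      qed
      then interpret I: ideal "Q.mono_ideal U" "A Quot K" by (rule Q.ideal_mono_ideal)
      have "b \<in> U" if b: "b \<in> B - T" "quot_coef x b \<noteq> 0" for b
      proof -
        obtain l where l: "b = bs ! l" "l < N" using b nth' by blast
        then have "k \<le> l" using zero[of l] b by (auto simp: \<phi>_def not_le[symmetric])
        then show ?thesis using l by (auto simp: U_def)
      qed
      then have "x \<in> Q.mono_ideal U" using ax by (intro Q.mono_idealI) (simp_all add: M)
      then have "a \<odot>\<^bsub>M\<^esub> x \<in> Q.mono_ideal U" using coset ax by (simp add: M I.I_l_closed)
      moreover have "j < N" "bs ! j \<notin> U" using idx[of j] j k by auto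
      ultimately show ?thesis using nth[of j] by (simp add: \<phi>_def Q.coef_mono_ideal)
    qed
    show "\<exists>a\<in>carrier A. \<forall>x\<in>carrier M. \<forall>i<N. \<phi> (a \<odot>\<^bsub>M\<^esub> x) i = c * \<phi> x i" for c
    proof (intro bexI[of _ "mon 0 c"] ballI allI impI)
      fix x i assume xi: "x \<in> carrier M" "i < N"
      have "quot_coef (quot_mon T 0 c \<otimes>\<^bsub>A Quot K\<^esub> y) b = c * quot_coef y b"
        if "y \<in> carrier (A Quot K)" "b \<in> B - T" for y b
        using that(1)
      proof (induction rule: Q.mon_induct[where T = UNIV, case_names support zero mon add])
        case zero
        show ?case using T0 that by simp
      next
        case (mon b' c')
        then show ?case using T0 that by (simp add: Q.mon_mult Q.coef_mon)
      next
        case (add p q)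
        then show ?case using T0 that by (simp add: Q.r_distr Q.coef_add algebra_simps)
      qed simp
      then show "\<phi> (mon 0 c \<odot>\<^bsub>M\<^esub> x) i = c * \<phi> x i"
        using xi nth by (simp add: M \<phi>_def quot_mon_def K_def)
    qed simp
  qed
  then show ?thesis using N by (simp add: M_def K_def)
qed

section \<open>The Rees algebra of the irrelevant ideal\<close>

text \<open>A grading by \<open>deg\<close> in which 1 is the only monomial of degree 0 and the monomials of degree 1
  generate all others.\<close>

locale graded_monomial_cring = monomial_cring A B coef mon
  for A :: "('a, 'm) ring_scheme" (structure) and B :: "'b::comm_monoid_add set"
    and coef :: "'a \<Rightarrow> 'b \<Rightarrow> 'k::field" and mon +
  fixes deg :: "'b \<Rightarrow> nat"
  assumes deg_add: "b \<in> B \<Longrightarrow> b' \<in> B \<Longrightarrow> deg (b + b') = deg b + deg b'"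
    and deg_eq_0: "b \<in> B \<Longrightarrow> deg b = 0 \<Longrightarrow> b = 0"
    and split_degree_one: "b \<in> B \<Longrightarrow> 0 < deg b \<Longrightarrow> \<exists>t\<in>B. \<exists>u\<in>B. b = u + t \<and> deg t = 1"
begin

lemma deg_zero [simp]: "deg 0 = 0"
  using deg_add[of 0 0] by simp

definition irrelevant_ideal :: "'a set" where
  "irrelevant_ideal = mono_ideal {b. 1 \<le> deg b}"

lemma absorbing_deg: "absorbing {b. n \<le> deg b}"
  by (auto simp: absorbing_def deg_add)

text \<open>Generation in degree 1 makes the \<open>n\<close>-th power of the irrelevant ideal the full span of
  the monomials of degree at least \<open>n\<close>: such a monomial of degree at least \<open>n + 1\<close> splits off a factor
  of degree 1.\<close>

lemma irrelevant_ideal_power: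
  "irrelevant_ideal [^]\<^bsub>ideals_set A\<^esub> n = mono_ideal {b. n \<le> deg b}"
proof (induction n)
  interpret I: semiring "ideals_set A" by (rule ideals_set_is_semiring)
  case 0
  show ?case by (auto simp: ideals_set_def mono_ideal_def)
next
  interpret I: semiring "ideals_set A" by (rule ideals_set_is_semiring)
  case (Suc n)
  have "irrelevant_ideal [^]\<^bsub>ideals_set A\<^esub> Suc n = mono_ideal {b. n \<le> deg b} \<cdot> mono_ideal {b. 1 \<le> deg b}"
    by (simp only: I.nat_pow_Suc Suc irrelevant_ideal_def[symmetric])
       (simp add: ideals_set_def)
  also have "\<dots> = mono_ideal {b. Suc n \<le> deg b}"
    unfolding ideal_prod_mono_ideal
  proof (rule mono_ideal_cong, intro equalityI subsetI)
    fix b assume "b \<in> B \<inter> {b. \<exists>t\<in>B \<inter> {b. n \<le> deg b}. \<exists>u\<in>B \<inter> {b. 1 \<le> deg b}. b = t + u}"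
    then show "b \<in> B \<inter> {b. Suc n \<le> deg b}" by (auto simp: deg_add)
  next
    fix b assume b: "b \<in> B \<inter> {b. Suc n \<le> deg b}"
    then obtain t u where "t \<in> B" "u \<in> B" "b = u + t" "deg t = 1" using split_degree_one[of b] by auto
    moreover from this have "u \<in> B \<inter> {b. n \<le> deg b}" "t \<in> B \<inter> {b. 1 \<le> deg b}"
      using b by (simp_all add: deg_add)
    ultimately show "b \<in> B \<inter> {b. \<exists>t\<in>B \<inter> {b. n \<le> deg b}. \<exists>u\<in>B \<inter> {b. 1 \<le> deg b}. b = t + u}"
      using b by blast
  qed
  finally show ?case .
qed

text \<open>The pair \<open>(b, n)\<close> is the exponent of the monomial \<open>x\<^sup>b t\<^sup>n\<close>.\<close>

definition rees_basis :: "('b \<times> nat) set" where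
  "rees_basis = {(b, n). b \<in> B \<and> n \<le> deg b}"

definition rees_coef :: "(nat \<Rightarrow> 'a) \<Rightarrow> 'b \<times> nat \<Rightarrow> 'k" where
  "rees_coef p = (\<lambda>(b, n). coef (up_ring.coeff (UP A) p n) b)"

definition rees_mon :: "'b \<times> nat \<Rightarrow> 'k \<Rightarrow> nat \<Rightarrow> 'a" where
  "rees_mon = (\<lambda>(b, n) c. up_ring.monom (UP A) (mon b c) n)"

sublocale UP: UP_cring A "UP A"
  by (simp_all add: UP_cring_def is_cring)

lemma rees_algebra_eq: "rees_algebra A irrelevant_ideal =
    (UP A)\<lparr>carrier := {p \<in> carrier (UP A). \<forall>n. up_ring.coeff (UP A) p n \<in> mono_ideal {b. n \<le> deg b}}\<rparr>"
  by (simp add: rees_algebra_def irrelevant_ideal_power)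

lemma cring_rees_algebra: "cring (rees_algebra A irrelevant_ideal)"
proof -
  let ?H = "{p \<in> carrier (UP A). \<forall>n. up_ring.coeff (UP A) p n \<in> mono_ideal {b. n \<le> deg b}}"
  have I: "ideal (mono_ideal {b. n \<le> deg b}) A" for n
    by (rule ideal_mono_ideal[OF absorbing_deg])
  have "subring ?H (UP A)"
  proof (rule UP.P.subringI)
    show "?H \<subseteq> carrier (UP A)" by auto
    show "\<one>\<^bsub>UP A\<^esub> \<in> ?H"
      by (auto simp: mono_ideal_def)
  next
    fix p assume "p \<in> ?H"
    then show "\<ominus>\<^bsub>UP A\<^esub> p \<in> ?H"
      using I by (auto simp: additive_subgroup.a_inv_closed ideal.axioms(1))
  next
    fix p q assume pq: "p \<in> ?H" "q \<in> ?H"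
    then show "p \<oplus>\<^bsub>UP A\<^esub> q \<in> ?H" by (simp add: add_mono_ideal)
    have "(\<Oplus>i\<in>{..n}. up_ring.coeff (UP A) p i \<otimes> up_ring.coeff (UP A) q (n - i)) \<in> mono_ideal {b. n \<le> deg b}" for n
    proof (rule mono_idealI)
      let ?f = "\<lambda>i. up_ring.coeff (UP A) p i \<otimes> up_ring.coeff (UP A) q (n - i)"
      have f: "?f i \<in> mono_ideal {b. n \<le> deg b}" if "i \<in> {..n}" for i
        using pq that by (intro mult_mono_ideal[where T = "{b. i \<le> deg b}" and U = "{b. n - i \<le> deg b}"])
          (auto simp: deg_add)
      have fc: "?f \<in> {..n} \<rightarrow> carrier A" using f mono_ideal_carrier by blast
      show "(\<Oplus>i\<in>{..n}. ?f i) \<in> carrier A" using fc by (rule finsum_closed)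
      fix b assume b: "b \<in> B" "coef (\<Oplus>i\<in>{..n}. ?f i) b \<noteq> 0"
      then have "(\<Sum>i\<le>n. coef (?f i) b) \<noteq> 0" using coef_finsum[of "{..n}" ?f b] fc by simp
      then obtain i where "i \<in> {..n}" "coef (?f i) b \<noteq> 0" by (rule sum.not_neutral_contains_not_neutral)
      then show "b \<in> {b. n \<le> deg b}" using f coef_mono_ideal b(1) by blast
    qed
    then show "p \<otimes>\<^bsub>UP A\<^esub> q \<in> ?H" using pq by simp
  qed
  then show ?thesis
    unfolding rees_algebra_eq
    by (intro UP.P.subcring_iff[THEN iffD1] UP.P.subcringI') auto
qed

text \<open>The monomials \<open>x\<^sup>b t\<^sup>n\<close> with \<open>n \<le> deg b\<close> are a basis of the Rees algebra, so the Rees algebra is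
  itself a ring with a monomial basis, and the results on generated ideals and on length apply
  to it.\<close>

lemma monomial_cring_rees:
  "monomial_cring (rees_algebra A irrelevant_ideal) rees_basis rees_coef rees_mon"
proof -
  interpret Rees: cring "rees_algebra A irrelevant_ideal" by (rule cring_rees_algebra)
  have carrier: "p \<in> carrier (rees_algebra A irrelevant_ideal) \<longleftrightarrow>
      p \<in> carrier (UP A) \<and> (\<forall>n. up_ring.coeff (UP A) p n \<in> mono_ideal {b. n \<le> deg b})" for p
    by (simp add: rees_algebra_eq)
  have ops: "monoid.mult (rees_algebra A irrelevant_ideal) = monoid.mult (UP A)"
    "add (rees_algebra A irrelevant_ideal) = add (UP A)"
    "\<one>\<^bsub>rees_algebra A irrelevant_ideal\<^esub> = \<one>\<^bsub>UP A\<^esub>"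
    "\<zero>\<^bsub>rees_algebra A irrelevant_ideal\<^esub> = \<zero>\<^bsub>UP A\<^esub>"
    by (simp_all add: rees_algebra_eq)
  have sum_basis: "\<beta> + \<beta>' \<in> rees_basis \<longleftrightarrow> fst \<beta> + fst \<beta>' \<in> B" if "\<beta> \<in> rees_basis" "\<beta>' \<in> rees_basis" for \<beta> \<beta>'
    using that by (auto simp: rees_basis_def deg_add)
  show ?thesis
  proof
    fix \<beta> :: "'b \<times> nat" and c assume \<beta>: "\<beta> \<in> rees_basis"
    show "rees_mon \<beta> c \<in> carrier (rees_algebra A irrelevant_ideal)"
      using \<beta> by (auto simp: carrier rees_mon_def rees_basis_def mon_mono_ideal)
    show "rees_coef (rees_mon \<beta> c) \<beta>' = (if \<beta>' = \<beta> then c else 0)" if "\<beta>' \<in> rees_basis" for \<beta>'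
      using \<beta> that by (auto simp: rees_mon_def rees_basis_def rees_coef_def coef_mon split: if_splits)
    show "rees_coef (p \<oplus>\<^bsub>rees_algebra A irrelevant_ideal\<^esub> q) \<beta> = rees_coef p \<beta> + rees_coef q \<beta>"
      if "p \<in> carrier (rees_algebra A irrelevant_ideal)" "q \<in> carrier (rees_algebra A irrelevant_ideal)" for p q
      using \<beta> that by (auto simp: rees_coef_def rees_basis_def carrier ops coef_add)
    show "rees_mon \<beta> c \<otimes>\<^bsub>rees_algebra A irrelevant_ideal\<^esub> rees_mon \<beta>' c' =
        (if \<beta> + \<beta>' \<in> rees_basis then rees_mon (\<beta> + \<beta>') (c * c') else \<zero>\<^bsub>rees_algebra A irrelevant_ideal\<^esub>)"
      if \<beta>': "\<beta>' \<in> rees_basis" for \<beta>' c'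
    proof -
      obtain b n b' n' where eq: "\<beta> = (b, n)" "\<beta>' = (b', n')" by fastforce
      then have "b \<in> B" "b' \<in> B" using \<beta> \<beta>' by (auto simp: rees_basis_def)
      then have "rees_mon \<beta> c \<otimes>\<^bsub>rees_algebra A irrelevant_ideal\<^esub> rees_mon \<beta>' c' =
          up_ring.monom (UP A) (mon b c \<otimes> mon b' c') (n + n')"
        by (simp add: rees_mon_def eq ops UP.monom_mult)
      then show ?thesis
        using sum_basis[OF \<beta> \<beta>'] \<open>b \<in> B\<close> \<open>b' \<in> B\<close> by (simp add: mon_mult eq rees_mon_def ops)
    qed
  next
    fix p q assume pq: "p \<in> carrier (rees_algebra A irrelevant_ideal)"
      "q \<in> carrier (rees_algebra A irrelevant_ideal)"
      and eq: "\<And>\<beta>. \<beta> \<in> rees_basis \<Longrightarrow> rees_coef p \<beta> = rees_coef q \<beta>"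
    have "up_ring.coeff (UP A) p n = up_ring.coeff (UP A) q n" for n
    proof (rule coef_inj)
      fix b assume b: "b \<in> B"
      show "coef (up_ring.coeff (UP A) p n) b = coef (up_ring.coeff (UP A) q n) b"
      proof (cases "n \<le> deg b")
        case True
        then show ?thesis using eq[of "(b, n)"] b by (simp add: rees_basis_def rees_coef_def)
      next
        case False
        have "up_ring.coeff (UP A) p n \<in> mono_ideal {b. n \<le> deg b}"
          "up_ring.coeff (UP A) q n \<in> mono_ideal {b. n \<le> deg b}" using pq carrier by auto
        then show ?thesis using coef_mono_ideal[of _ "{b. n \<le> deg b}" b] b False by simp
      qed
    qed (use pq carrier in auto)
    then show "p = q" using pq carrier by (intro UP.up_eqI) auto
  next
    fix p assume p: "p \<in> carrier (rees_algebra A irrelevant_ideal)"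
    obtain N where N: "\<And>n. N < n \<Longrightarrow> up_ring.coeff (UP A) p n = \<zero>"
      using UP.deg_aboveD p carrier by blast
    have c: "up_ring.coeff (UP A) p n \<in> carrier A" for n using p carrier by auto
    have "{\<beta> \<in> rees_basis. rees_coef p \<beta> \<noteq> 0} \<subseteq>
        (\<Union>n\<le>N. {b \<in> B. coef (up_ring.coeff (UP A) p n) b \<noteq> 0} \<times> {n})"
    proof
      fix \<beta> assume "\<beta> \<in> {\<beta> \<in> rees_basis. rees_coef p \<beta> \<noteq> 0}"
      then obtain b n where b: "\<beta> = (b, n)" "b \<in> B" "coef (up_ring.coeff (UP A) p n) b \<noteq> 0"
        by (auto simp: rees_basis_def rees_coef_def)
      then have "n \<le> N" using N[of n] by (cases "n \<le> N") auto
      then show "\<beta> \<in> (\<Union>n\<le>N. {b \<in> B. coef (up_ring.coeff (UP A) p n) b \<noteq> 0} \<times> {n})" using b by auto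
    qed
    then show "finite {\<beta> \<in> rees_basis. rees_coef p \<beta> \<noteq> 0}"
      using finite_subset coef_finite[OF c] by (metis (no_types, lifting) finite_UN finite_atMost finite_SigmaI finite.emptyI finite.insertI)
  next
    show "(0 :: 'b \<times> nat) \<in> rees_basis" by (simp add: rees_basis_def zero_prod_def)
    show "\<one>\<^bsub>rees_algebra A irrelevant_ideal\<^esub> = rees_mon 0 1"
      by (simp add: ops rees_mon_def zero_prod_def UP.monom_one flip: one_eq_mon)
  qed
qed

end

section \<open>Counting the surviving monomials\<close>

text \<open>Monomials with support \<open>insert a F\<close> correspond to pairs of a monomial with support \<open>F\<close> and a positive
  exponent of the variable \<open>a\<close>. The counts below are by induction on the support along this
  correspondence.\<close>

lemma inj_on_insert_key:
  fixes F :: "nat set"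
  assumes "a \<notin> F"
  shows "inj_on (\<lambda>(j, m). m + single a j) {(j :: nat, m). keys m = F}"
proof (rule inj_onI, clarify)
  fix j j' :: nat and m m' :: "nat \<Rightarrow>\<^sub>0 nat"
  assume F: "F = keys m" "keys m' = keys m" and eq: "m + single a j = m' + single a j'"
  have "lookup m a = 0" "lookup m' a = 0"
    using F assms not_in_keys_iff_lookup_eq_zero by metis+
  then have "j = j'" using arg_cong[OF eq, of "\<lambda>q. lookup q a"] by (simp add: lookup_add)
  then show "j = j' \<and> m = m'" using eq by simp
qed

lemma insert_key_cases:
  fixes m :: "nat \<Rightarrow>\<^sub>0 nat"
  assumes "keys m = insert a F" "a \<notin> F"
  obtains j m' where "m = m' + single a j" "keys m' = F" "1 \<le> j" "lookup m a = j"
proof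
  show "m = (m - single a (lookup m a)) + single a (lookup m a)" by (simp add: diff_single_add)
  show "keys (m - single a (lookup m a)) = F"
    using assms by (auto simp: in_keys_iff lookup_minus lookup_single when_def set_eq_iff split: if_splits)
  show "1 \<le> lookup m a" using assms by (metis One_nat_def Suc_leI gr0I in_keys_iff insertI1)
qed simp

lemma keys_insert_key:
  fixes m :: "nat \<Rightarrow>\<^sub>0 nat"
  assumes "keys m = F" "1 \<le> j"
  shows "keys (m + single a j) = insert a F"
  using assms by (auto simp: keys_add_nat)

definition monomials_upto :: "nat set \<Rightarrow> nat \<Rightarrow> (nat \<Rightarrow>\<^sub>0 nat) set" where
  "monomials_upto F t = {m. keys m = F \<and> total_degree m \<le> t}"

lemma sum_choose_diff: "(\<Sum>j=1..t. (t - j) choose k) = t choose Suc k"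
proof (induction t)
  case (Suc t)
  have "(\<Sum>j=1..Suc t. (Suc t - j) choose k) = (t choose k) + (\<Sum>j=Suc 1..Suc t. (Suc t - j) choose k)"
    by (subst sum.atLeast_Suc_atMost) auto
  also have "(\<Sum>j=Suc 1..Suc t. (Suc t - j) choose k) = (\<Sum>j=1..t. (t - j) choose k)"
    by (subst sum.shift_bounds_cl_Suc_ivl) simp
  finally show ?case using Suc by simp
qed simp

lemma card_monomials_upto:
  assumes "finite F"
  shows "finite (monomials_upto F t) \<and> card (monomials_upto F t) = t choose card F"
  using assms
proof (induction F arbitrary: t)
  case empty
  have "monomials_upto {} t = {0}" by (auto simp: monomials_upto_def)
  then show ?case by simp
next
  case (insert a F)
  let ?f = "\<lambda>(j, m). m + single a j" and ?X = "SIGMA j:{1..t}. monomials_upto F (t - j)"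
  have "?f ` ?X = monomials_upto (insert a F) t"
  proof (intro equalityI subsetI)
    fix m assume "m \<in> ?f ` ?X"
    then show "m \<in> monomials_upto (insert a F) t"
      by (auto simp: monomials_upto_def total_degree_add keys_add_nat)
  next
    fix m assume m: "m \<in> monomials_upto (insert a F) t"
    then have "keys m = insert a F" by (simp add: monomials_upto_def)
    then obtain j m' where jm: "m = m' + single a j" "keys m' = F" "1 \<le> j"
      using insert.hyps by (metis insert_key_cases)
    then have "(j, m') \<in> ?X" using m by (auto simp: monomials_upto_def total_degree_add)
    then show "m \<in> ?f ` ?X" using jm by force
  qed
  moreover have "inj_on ?f ?X"
    using inj_on_insert_key[OF insert.hyps(2)] by (rule inj_on_subset) (auto simp: monomials_upto_def)
  ultimately have bij: "bij_betw ?f ?X (monomials_upto (insert a F) t)" by (simp add: bij_betw_def)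
  have fin: "finite ?X" using insert.IH by blast
  have "card ?X = (\<Sum>j=1..t. (t - j) choose card F)" using insert.IH by simp
  then show ?case
    using bij_betw_same_card[OF bij] bij_betw_finite[OF bij] fin insert.hyps sum_choose_diff[of t "card F"]
    by simp
qed

text \<open>The cube of exponent vectors with support \<open>F\<close> and entries between 1 and \<open>s - 1\<close>.\<close>

definition box :: "nat set \<Rightarrow> nat \<Rightarrow> (nat \<Rightarrow>\<^sub>0 nat) set" where
  "box F s = {m. keys m = F \<and> (\<forall>i\<in>F. lookup m i < s)}"

lemma bij_betw_box_insert:
  assumes "a \<notin> F"
  shows "bij_betw (\<lambda>(j, m). m + single a j) ({1..<s} \<times> box F s) (box (insert a F) s)"
  (is "bij_betw ?f ?X _")
proof (rule bij_betw_imageI)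
  show "inj_on ?f ?X"
    using inj_on_insert_key[OF assms] by (rule inj_on_subset) (auto simp: box_def)
  show "?f ` ?X = box (insert a F) s"
  proof (intro equalityI subsetI)
    fix m assume "m \<in> ?f ` ?X"
    then obtain j m' where jm: "m = m' + single a j" "1 \<le> j" "j < s" "m' \<in> box F s" by auto
    then have "lookup m' a = 0" using assms by (auto simp: box_def in_keys_iff)
    then show "m \<in> box (insert a F) s"
      using jm assms keys_insert_key[of m' F j a]
      by (auto simp: box_def lookup_add lookup_single when_def)
  next
    fix m assume m: "m \<in> box (insert a F) s"
    then have "keys m = insert a F" by (simp add: box_def)
    then obtain j m' where jm: "m = m' + single a j" "keys m' = F" "1 \<le> j" "lookup m a = j"
      using assms by (metis insert_key_cases)
    moreover have "lookup m' i \<le> lookup m i" for i using jm by (simp add: lookup_add)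
    ultimately have "(j, m') \<in> ?X" using m by (fastforce simp: box_def intro: le_less_trans)
    then show "m \<in> ?f ` ?X" using jm by force
  qed
qed

lemma card_box:
  assumes "finite F"
  shows "finite (box F s) \<and> card (box F s) = (s - 1) ^ card F"
  using assms
proof (induction F)
  case empty
  have "box {} s = {0}" by (auto simp: box_def)
  then show ?case by simp
next
  case (insert a F)
  note bij = bij_betw_box_insert[OF insert.hyps(2), of s]
  show ?case
    using bij_betw_same_card[OF bij] bij_betw_finite[OF bij] insert by (simp add: card_cartesian_product)
qed

lemma sum_total_degree_box:
  assumes "finite F"
  shows "2 * (\<Sum>m\<in>box F s. total_degree m) = card F * s * (s - 1) ^ card F"
  using assms
proof (induction F)
  case empty
  have "box {} s = {0}" by (auto simp: box_def)
  then show ?case by simp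
next
  case (insert a F)
  let ?D = "\<Sum>m\<in>box F s. total_degree m" and ?n = "card F"
  have fin: "finite (box F s)" and card: "card (box F s) = (s - 1) ^ ?n" using card_box insert by auto
  have "(\<Sum>m\<in>box (insert a F) s. total_degree m) = (\<Sum>(j, m)\<in>{1..<s} \<times> box F s. total_degree m + j)"
    using sum.reindex_bij_betw[OF bij_betw_box_insert[OF insert.hyps(2), of s], of total_degree]
    by (simp add: case_prod_unfold total_degree_add)
  also have "\<dots> = (\<Sum>j\<in>{1..<s}. \<Sum>m\<in>box F s. total_degree m + j)"
    using fin by (simp add: sum.cartesian_product)
  also have "\<dots> = (s - 1) * ?D + (s - 1) ^ ?n * (\<Sum>j\<in>{1..<s}. j)"
    by (simp add: sum.distrib card sum_distrib_left)
  finally have "2 * (\<Sum>m\<in>box (insert a F) s. total_degree m) =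
      (s - 1) * (2 * ?D) + (s - 1) ^ ?n * (2 * (\<Sum>j\<in>{1..<s}. j))" by simp
  also have "2 * (\<Sum>j\<in>{1..<s}. j) = s * (s - 1)"
    by (induction s) (auto simp: algebra_simps sum.atLeastLessThan_Suc)
  finally show ?case using insert by (simp add: algebra_simps)
qed

text \<open>With \<open>B\<close> the monomial basis of the Rees algebra, \<open>x\<^sup>m t\<^sup>n\<close> in \<open>B\<close> is \<open>x\<^sub>i\<^sup>s\<close> times an element of \<open>B\<close> iff
  \<open>m\<^sub>i \<ge> s\<close> and \<open>n \<le> |m| - s\<close>, and it is \<open>x\<^sub>i\<^sup>s t\<^sup>s\<close> times an element of \<open>B\<close> iff \<open>m\<^sub>i \<ge> s\<close> and \<open>n \<ge> s\<close>. The
  survivors are the monomials with support \<open>F\<close> for which neither happens at any \<open>i\<close>.\<close>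

definition survivors :: "nat set \<Rightarrow> nat \<Rightarrow> ((nat \<Rightarrow>\<^sub>0 nat) \<times> nat) set" where
  "survivors F s = {(m, n). keys m = F \<and> n \<le> total_degree m \<and>
     (\<forall>i\<in>F. lookup m i < s \<or> total_degree m < n + s \<and> n < s)}"

definition large_survivors :: "nat set \<Rightarrow> nat \<Rightarrow> nat \<Rightarrow> ((nat \<Rightarrow>\<^sub>0 nat) \<times> nat) set" where
  "large_survivors F s i = {(m, n). keys m = F \<and> s \<le> lookup m i \<and> total_degree m < n + s \<and> n < s}"

lemma survivors_eq:
  "survivors F s = (SIGMA m:box F s. {..total_degree m}) \<union> (\<Union>i\<in>F. large_survivors F s i)"
proof (intro equalityI subsetI)
  fix \<beta> assume "\<beta> \<in> survivors F s"
  then show "\<beta> \<in> (SIGMA m:box F s. {..total_degree m}) \<union> (\<Union>i\<in>F. large_survivors F s i)"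
    by (fastforce simp: survivors_def box_def large_survivors_def not_less)
next
  fix \<beta> assume "\<beta> \<in> (SIGMA m:box F s. {..total_degree m}) \<union> (\<Union>i\<in>F. large_survivors F s i)"
  then show "\<beta> \<in> survivors F s"
  proof
    assume "\<beta> \<in> (SIGMA m:box F s. {..total_degree m})"
    then show ?thesis by (auto simp: survivors_def box_def)
  next
    assume "\<beta> \<in> (\<Union>i\<in>F. large_survivors F s i)"
    then obtain m n i where "\<beta> = (m, n)" "keys m = F" "s \<le> lookup m i" "total_degree m < n + s" "n < s"
      by (auto simp: large_survivors_def)
    then show ?thesis using lookup_le_total_degree[of m i] by (auto simp: survivors_def)
  qed
qed

text \<open>The fresh variable \<open>a\<close> absorbs the exponent of \<open>t\<close>. The new degree is
  \<open>|m| - (s - 1) + (s - n)\<close>, which is at most \<open>s\<close> iff \<open>|m| < n + s\<close>; the new exponents are positive iff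
  \<open>m\<^sub>i \<ge> s\<close> and \<open>n < s\<close>.\<close>

lemma bij_betw_large_survivors:
  assumes i: "i \<in> F" and a: "a \<notin> F" and s: "1 \<le> s"
  shows "bij_betw (\<lambda>(m, n). (m - single i (s - 1)) + single a (s - n))
    (large_survivors F s i) (monomials_upto (insert a F) s)"
proof (rule bij_betw_byWitness[where f' = "\<lambda>m. ((m - single a (lookup m a)) + single i (s - 1), s - lookup m a)"])
  have ia: "i \<noteq> a" using i a by blast
  have a0: "lookup m a = 0" if "keys m = F" for m :: "nat \<Rightarrow>\<^sub>0 nat"
    using that a not_in_keys_iff_lookup_eq_zero by metis
  have keys_minus: "keys (m - single i (s - 1)) = keys m" if "s \<le> lookup m i" for m :: "nat \<Rightarrow>\<^sub>0 nat"
    using that s by (auto simp: in_keys_iff lookup_minus lookup_single when_def)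
  show "\<forall>\<beta>\<in>large_survivors F s i. (\<lambda>m. ((m - single a (lookup m a)) + single i (s - 1), s - lookup m a))
      ((\<lambda>(m, n). (m - single i (s - 1)) + single a (s - n)) \<beta>) = \<beta>"
  proof
    fix \<beta> assume "\<beta> \<in> large_survivors F s i"
    then obtain m n where *: "keys m = F" "s \<le> lookup m i" "n < s" and \<beta>: "\<beta> = (m, n)"
      by (auto simp: large_survivors_def)
    have "lookup ((m - single i (s - 1)) + single a (s - n)) a = s - n"
      using a0[OF *(1)] by (simp add: lookup_add lookup_minus)
    then show "(\<lambda>m. ((m - single a (lookup m a)) + single i (s - 1), s - lookup m a))
      ((\<lambda>(m, n). (m - single i (s - 1)) + single a (s - n)) \<beta>) = \<beta>"
      using * by (simp add: diff_single_add \<beta>)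
  qed
  show "\<forall>m\<in>monomials_upto (insert a F) s. (\<lambda>(m, n). (m - single i (s - 1)) + single a (s - n))
      ((m - single a (lookup m a)) + single i (s - 1), s - lookup m a) = m"
  proof
    fix m assume "m \<in> monomials_upto (insert a F) s"
    then have "lookup m a \<le> s" using lookup_le_total_degree[of m a] by (simp add: monomials_upto_def)
    then show "(\<lambda>(m, n). (m - single i (s - 1)) + single a (s - n))
      ((m - single a (lookup m a)) + single i (s - 1), s - lookup m a) = m"
      by (simp add: diff_single_add)
  qed
  show "(\<lambda>(m, n). (m - single i (s - 1)) + single a (s - n)) ` large_survivors F s i \<subseteq> monomials_upto (insert a F) s"
  proof clarify
    fix m n assume "(m, n) \<in> large_survivors F s i"
    then have *: "keys m = F" "s \<le> lookup m i" "n < s" "total_degree m < n + s" by (auto simp: large_survivors_def)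
    have "total_degree m = total_degree (m - single i (s - 1)) + (s - 1)"
      using * by (intro total_degree_diff_single) simp
    moreover have "keys (m - single i (s - 1) + single a (s - n)) = insert a F"
      using * keys_minus by (simp add: keys_insert_key)
    ultimately show "m - single i (s - 1) + single a (s - n) \<in> monomials_upto (insert a F) s"
      using * by (simp add: monomials_upto_def total_degree_add)
  qed
  show "(\<lambda>m. ((m - single a (lookup m a)) + single i (s - 1), s - lookup m a)) ` monomials_upto (insert a F) s
      \<subseteq> large_survivors F s i"
  proof clarify
    fix m assume m: "m \<in> monomials_upto (insert a F) s"
    then have km: "keys m = insert a F" "total_degree m \<le> s" by (auto simp: monomials_upto_def)
    let ?m = "(m - single a (lookup m a)) + single i (s - 1)"
    have "keys ?m = F"
      using km i a ia by (auto simp: in_keys_iff lookup_add lookup_minus lookup_single when_def set_eq_iff split: if_splits)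
    moreover have "1 \<le> lookup m i" "1 \<le> lookup m a"
      using km i by (simp_all add: Suc_le_eq in_keys_iff[symmetric] flip: neq0_conv)
    moreover have "lookup ?m i = lookup m i + (s - 1)"
      using ia by (simp add: lookup_add lookup_minus lookup_single when_def)
    moreover have "total_degree ?m = total_degree m - lookup m a + (s - 1)"
      using total_degree_diff_single[of "lookup m a" m a] by (simp add: total_degree_add)
    moreover have "lookup m a \<le> total_degree m" by (rule lookup_le_total_degree)
    ultimately show "(?m, s - lookup m a) \<in> large_survivors F s i"
      using s km by (auto simp: large_survivors_def)
  qed
qed

text \<open>The survivors with all exponents below \<open>s\<close> contribute \<open>|m| + 1\<close> values of \<open>n\<close> for each \<open>m\<close> in the
  cube. The remaining ones split according to the unique position of the large exponent. The count is
  doubled to stay within the natural numbers.\<close>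

lemma card_survivors:
  assumes F: "finite F" and s: "1 \<le> s"
  shows "finite (survivors F s)"
    and "2 * card (survivors F s) = 2 * (s - 1) ^ card F + card F * s * (s - 1) ^ card F + 2 * card F * (s choose Suc (card F))"
proof -
  obtain a where a: "a \<notin> F" using F ex_new_if_finite infinite_UNIV_nat by blast
  let ?small = "SIGMA m:box F s. {..total_degree m}"
  have large: "finite (large_survivors F s i)" "card (large_survivors F s i) = s choose Suc (card F)" if "i \<in> F" for i
    using card_monomials_upto[of "insert a F" s] F a
      bij_betw_same_card[OF bij_betw_large_survivors[OF that a s]]
      bij_betw_finite[OF bij_betw_large_survivors[OF that a s]] by simp_all
  have disj: "large_survivors F s i \<inter> large_survivors F s j = {}" if "i \<noteq> j" for i j
  proof -
    have False if *: "keys m = F" "s \<le> lookup m i" "s \<le> lookup m j" "total_degree m < n + s" "n < s" for m n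
      using lookup_two_le_total_degree[OF \<open>i \<noteq> j\<close>, of m] * by linarith
    then show ?thesis unfolding large_survivors_def by blast
  qed
  have fin: "finite ?small" using card_box[OF F] by simp
  have "card ?small = (\<Sum>m\<in>box F s. Suc (total_degree m))" using card_box[OF F, of s] by simp
  also have "\<dots> = (\<Sum>m\<in>box F s. total_degree m) + card (box F s)" by (simp only: sum_Suc)
  finally have small: "2 * card ?small = card F * s * (s - 1) ^ card F + 2 * (s - 1) ^ card F"
    using sum_total_degree_box[OF F, of s] card_box[OF F, of s] by simp
  have "?small \<inter> (\<Union>i\<in>F. large_survivors F s i) = {}"
    by (auto simp: box_def large_survivors_def not_less[symmetric])
  then have "card (survivors F s) = card ?small + card (\<Union>i\<in>F. large_survivors F s i)"
    unfolding survivors_eq using fin F large by (intro card_Un_disjoint) auto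
  also have "card (\<Union>i\<in>F. large_survivors F s i) = card F * (s choose Suc (card F))"
    using F large disj by (subst card_UN_disjoint) auto
  finally show "2 * card (survivors F s) = 2 * (s - 1) ^ card F + card F * s * (s - 1) ^ card F + 2 * card F * (s choose Suc (card F))"
    using small by simp
  show "finite (survivors F s)" unfolding survivors_eq using fin F large by auto
qed

text \<open>The bound \<open>s \<ge> 1\<close> keeps the truncated difference \<open>s - 1\<close> in the count equal to the value of \<open>X - 1\<close> at \<open>s\<close>.\<close>

lemma poly_card_survivors:
  assumes "finite F"
  shows "\<exists>Q :: rat poly. \<forall>s\<ge>1. of_nat (card (survivors F s)) = poly Q (of_nat s)"
proof -
  let ?f = "card F"
  define C :: "rat poly" where "C = smult (1 / fact (Suc ?f)) (\<Prod>i = 0..<Suc ?f. [:- of_nat i, 1:])"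
  have C: "of_nat (s choose Suc ?f) = poly C (of_nat s)" for s
    unfolding binomial_gbinomial gbinomial_prod_rev
    by (simp only: of_nat_id C_def poly_prod poly_smult) (simp del: prod.atLeast0_lessThan_Suc)
  let ?Q = "[:-1, 1:] ^ ?f + smult (of_nat ?f / 2) ([:0, 1:] * [:-1, 1:] ^ ?f) + smult (of_nat ?f) C"
  have "of_nat (card (survivors F s)) = poly ?Q (of_nat s)" if "1 \<le> s" for s
  proof -
    have "(of_nat (2 * card (survivors F s)) :: rat) = 2 * poly ?Q (of_nat s)"
      unfolding card_survivors(2)[OF assms that]
      using that by (simp add: C of_nat_diff algebra_simps)
    then show ?thesis by simp
  qed
  then show ?thesis by blast
qed

section \<open>Squarefree monomial ideals and the length of the Frobenius quotient\<close>

lemma cring_mpoly_ring: "cring (mpoly_ring r :: 'k::field mpoly ring)"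
proof -
  let ?S = "mpoly_ring r :: 'k mpoly ring"
  have mem: "p \<in> carrier ?S \<longleftrightarrow> (\<forall>m\<in>keys p. keys m \<subseteq> {1..r})" for p
    by (simp add: mpoly_ring_def)
  have ops: "p \<otimes>\<^bsub>?S\<^esub> q = p * q" "p \<oplus>\<^bsub>?S\<^esub> q = p + q" "\<one>\<^bsub>?S\<^esub> = 1" "\<zero>\<^bsub>?S\<^esub> = 0" for p q
    by (simp_all add: mpoly_ring_def)
  have add: "p + q \<in> carrier ?S" if "p \<in> carrier ?S" "q \<in> carrier ?S" for p q
    using that Poly_Mapping.keys_add[of p q] unfolding mem by blast
  have uminus: "- p \<in> carrier ?S" if "p \<in> carrier ?S" for p
    using that unfolding mem by (simp add: in_keys_iff)
  have mult: "p * q \<in> carrier ?S" if "p \<in> carrier ?S" "q \<in> carrier ?S" for p q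
    unfolding mem
  proof
    fix m assume "m \<in> keys (p * q)"
    then obtain a b where "m = a + b" "a \<in> keys p" "b \<in> keys q" using keys_mult[of p q] by blast
    then show "keys m \<subseteq> {1..r}" using that unfolding mem by (simp add: keys_add_nat)
  qed
  have zero: "0 \<in> carrier ?S" and one: "1 \<in> carrier ?S" unfolding mem by simp_all
  show ?thesis
  proof (rule cringI)
    show "abelian_group ?S"
    proof (rule abelian_groupI)
      show "\<exists>q\<in>carrier ?S. q \<oplus>\<^bsub>?S\<^esub> p = \<zero>\<^bsub>?S\<^esub>" if "p \<in> carrier ?S" for p
        using uminus[OF that] by (intro bexI[of _ "- p"]) (simp_all add: ops)
    qed (simp_all add: ops add zero algebra_simps)
    show "comm_monoid ?S"
      by (rule comm_monoidI) (simp_all add: ops mult one algebra_simps)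
  qed (simp add: ops algebra_simps)
qed

lemma monomial_cring_mpoly_ring:
  "monomial_cring (mpoly_ring r :: 'k::field mpoly ring) {m. keys m \<subseteq> {1..r}} lookup single"
proof -
  interpret cring "mpoly_ring r :: 'k mpoly ring" by (rule cring_mpoly_ring)
  show ?thesis
  proof
    fix p q :: "'k mpoly"
    assume p: "p \<in> carrier (mpoly_ring r)" and q: "q \<in> carrier (mpoly_ring r)"
      and eq: "\<And>m. m \<in> {m. keys m \<subseteq> {1..r}} \<Longrightarrow> lookup p m = lookup q m"
    have "lookup p m = lookup q m" for m
    proof (cases "keys m \<subseteq> {1..r}")
      case False
      then have "m \<notin> keys p" "m \<notin> keys q" using p q by (auto simp: mpoly_ring_def)
      then show ?thesis by (simp add: in_keys_iff)
    qed (use eq in simp)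
    then show "p = q" by (rule poly_mapping_eqI)
  next
    fix p :: "'k mpoly"
    show "finite {m \<in> {m. keys m \<subseteq> {1..r}}. lookup p m \<noteq> 0}"
      by (rule finite_subset[of _ "keys p"]) (auto simp: in_keys_iff)
  qed (auto simp: mpoly_ring_def lookup_single when_def lookup_add mult_single keys_add_nat)
qed

lemma genideal_Var:
  assumes V: "V \<subseteq> {1..r}"
  shows "genideal (mpoly_ring r :: 'k::field mpoly ring) (Var ` V) =
    monomial_cring.mono_ideal (mpoly_ring r) {m. keys m \<subseteq> {1..r}} lookup {m. keys m \<inter> V \<noteq> {}}"
proof -
  let ?S = "mpoly_ring r :: 'k mpoly ring"
  define B where "B = {m :: nat \<Rightarrow>\<^sub>0 nat. keys m \<subseteq> {1..r}}"
  interpret S: monomial_cring ?S B lookup single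
    unfolding B_def by (rule monomial_cring_mpoly_ring)
  let ?G = "(\<lambda>i. single i (1::nat)) ` V"
  have "genideal ?S (Var ` V) = S.mono_ideal {b. \<exists>g\<in>?G. \<exists>b'\<in>B. b = g + b'}"
    using V by (intro S.genideal_mon) (auto simp: B_def Var_def)
  also have "\<dots> = S.mono_ideal {m. keys m \<inter> V \<noteq> {}}"
  proof (rule S.mono_ideal_cong, intro equalityI subsetI)
    fix m assume "m \<in> B \<inter> {m. keys m \<inter> V \<noteq> {}}"
    then obtain i where i: "m \<in> B" "i \<in> keys m" "i \<in> V" by blast
    then have "m = single i 1 + (m - single i 1)"
      using diff_single_add[of 1 m i] by (simp add: add.commute in_keys_iff Suc_le_eq)
    moreover have "m - single i 1 \<in> B" using i keys_diff_nat[of m "single i 1"] by (auto simp: B_def)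
    ultimately show "m \<in> B \<inter> {b. \<exists>g\<in>?G. \<exists>b'\<in>B. b = g + b'}" using i by blast
  qed (auto simp: keys_add_nat)
  finally show ?thesis unfolding B_def .
qed

theorem theorem3p4:
  fixes r \<alpha> \<delta> :: nat
    and d :: enat
    and P :: "nat \<Rightarrow> 'k::field mpoly set"
    and S :: "'k mpoly ring"
    and I \<mm> :: "'k mpoly set"
    and R :: "'k mpoly set ring"
    and \<nn> :: "'k mpoly set set"
    and x :: "nat \<Rightarrow> 'k mpoly set"
    and Rees :: "('k mpoly set, nat \<Rightarrow> 'k mpoly set) up_ring"
    and gens :: "(nat \<Rightarrow> 'k mpoly set) set"
  assumes S: "S = mpoly_ring r"
    and \<mm>: "\<mm> = genideal S (Var ` {1..r})"
    and \<alpha>: "\<alpha> \<ge> 2"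
    and P_distinct: "inj_on P {1..\<alpha>}"
    and P_gen: "\<And>i. i \<in> {1..\<alpha>} \<Longrightarrow> \<exists>V \<subseteq> {1..r}. P i = genideal S (Var ` V)"
    and I: "I = (\<Inter>i\<in>{1..\<alpha>}. P i)"
    and R: "R = S Quot I"
    and \<nn>: "\<nn> = (\<lambda>p. I +>\<^bsub>S\<^esub> p) ` \<mm>"
    and d: "d = krull_dim R"
    and x: "x = (\<lambda>i. I +>\<^bsub>S\<^esub> Var i)"
    and \<delta>: "\<delta> = Max {nat \<bar>u\<bar> | i u. a_invariant R (quot_grading r I) x r i = Fin u}"
    and Rees: "Rees = rees_algebra R \<nn>"
    and gens: "gens = {up_ring.monom (UP R) (x i) 0 | i. i \<in> {1..r}} \<union>
                      {up_ring.monom (UP R) (x i) 1 | i. i \<in> {1..r}}"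
  shows "\<exists>Q :: rat poly. \<forall>s > \<delta>. \<exists>N :: nat.
           module_length Rees (quot_module Rees (frobenius_power Rees gens s)) = enat N \<and>
           of_nat N = poly Q (of_nat s)"
proof -
  define B where "B = {m :: nat \<Rightarrow>\<^sub>0 nat. keys m \<subseteq> {1..r}}"
  interpret S: monomial_cring S B lookup single
    unfolding S B_def by (rule monomial_cring_mpoly_ring)
  have Var_ideal: "genideal S (Var ` V) = S.mono_ideal {m. keys m \<inter> V \<noteq> {}}" if "V \<subseteq> {1..r}" for V
    using genideal_Var[OF that] unfolding S B_def .
  obtain V where V: "\<And>i. i \<in> {1..\<alpha>} \<Longrightarrow> V i \<subseteq> {1..r} \<and> P i = genideal S (Var ` V i)"
    using P_gen by metis
  \<comment> \<open>The monomials of \<open>I\<close>: a monomial lies in every \<open>P i\<close> iff its support meets every \<open>V i\<close>.\<close>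
  define T where "T = {m :: nat \<Rightarrow>\<^sub>0 nat. \<forall>i\<in>{1..\<alpha>}. keys m \<inter> V i \<noteq> {}}"
  have one_mem: "1 \<in> {1..\<alpha>}" using \<alpha> by simp
  have "I = (\<Inter>i\<in>{1..\<alpha>}. S.mono_ideal {m. keys m \<inter> V i \<noteq> {}})"
    using V Var_ideal by (simp add: I)
  also have "\<dots> = S.mono_ideal T"
    using one_mem unfolding S.mono_ideal_def T_def by blast
  finally have I_eq: "I = S.mono_ideal T" .
  have T: "S.absorbing T" by (auto simp: S.absorbing_def T_def keys_add_nat)
  have T0: "0 \<notin> T" using \<alpha> by (auto simp: T_def)
  interpret R: monomial_cring R "B - T" S.quot_coef "S.quot_mon T"
    unfolding R I_eq by (rule S.monomial_cring_quotient[OF T T0])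
  have sub: "m' \<in> B - T" if "m \<in> B - T" "keys m' \<subseteq> keys m" for m m'
    using that by (fastforce simp: B_def T_def)
  interpret R: graded_monomial_cring R "B - T" S.quot_coef "S.quot_mon T" total_degree
  proof
    fix m assume m: "m \<in> B - T" "0 < total_degree m"
    then have "m \<noteq> 0" by (auto simp: total_degree_eq_0_iff)
    then obtain i where i: "i \<in> keys m" by fastforce
    have "m = (m - single i 1) + single i 1"
      using i diff_single_add[of 1 m i] by (simp add: in_keys_iff Suc_le_eq)
    moreover have "m - single i 1 \<in> B - T" "single i 1 \<in> B - T"
      using i keys_diff_nat[of m "single i 1"] by - (rule sub[OF m(1)], simp)+
    ultimately show "\<exists>t\<in>B - T. \<exists>u\<in>B - T. m = u + t \<and> total_degree t = 1" by force
  qed (simp_all add: total_degree_add total_degree_eq_0_iff)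
  have "\<nn> = R.mono_ideal {m. keys m \<inter> {1..r} \<noteq> {}}"
  proof -
    have "B \<inter> T \<subseteq> {m. keys m \<inter> {1..r} \<noteq> {}}"
      using one_mem V[OF one_mem] unfolding T_def by blast
    then show ?thesis
      using S.image_mono_ideal_quotient[OF T T0] Var_ideal[of "{1..r}"] unfolding \<nn> \<mm> R I_eq by simp
  qed
  also have "\<dots> = R.irrelevant_ideal"
  proof -
    have "keys m \<inter> {1..r} \<noteq> {} \<longleftrightarrow> 1 \<le> total_degree m" if "m \<in> B" for m
      using that total_degree_eq_0_iff[of m] by (auto simp: B_def Int_absorb2 Suc_le_eq)
    then show ?thesis
      unfolding R.irrelevant_ideal_def by (intro R.mono_ideal_cong) blast
  qed
  finally have Rees_eq: "Rees = rees_algebra R R.irrelevant_ideal" by (simp add: Rees)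
  interpret A: monomial_cring Rees R.rees_basis R.rees_coef R.rees_mon
    unfolding Rees_eq by (rule R.monomial_cring_rees)
  \<comment> \<open>The vertices of the complex: the image of \<open>Var i\<close> in \<open>R\<close> is zero for all other \<open>i\<close>.\<close>
  define W where "W = {i \<in> {1..r}. single i (1::nat) \<in> B - T}"
  have single_W: "single i n \<in> B - T" if "i \<in> W" for i n
    by (rule sub[of "single i 1"]) (use that in \<open>simp_all add: W_def\<close>)
  have x_W: "x i = S.quot_mon T (single i 1) 1" for i
    by (simp add: x S.quot_mon_def I_eq Var_def)
  have x_not_W: "x i = \<zero>\<^bsub>R\<^esub>" if "i \<in> {1..r}" "i \<notin> W" for i
    using that S.quot_mon_outside[OF T, of "single i 1" 1] by (auto simp: x_W W_def B_def R I_eq)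
  \<comment> \<open>The faces of the complex: the supports of the basis monomials of \<open>R\<close>.\<close>
  define \<Delta> where "\<Delta> = {F. F \<subseteq> {1..r} \<and> (\<exists>i\<in>{1..\<alpha>}. F \<inter> V i = {})}"
  have \<Delta>: "m \<in> B - T \<longleftrightarrow> keys m \<in> \<Delta>" for m
    by (auto simp: B_def T_def \<Delta>_def)
  have fin_\<Delta>: "finite \<Delta>" by (rule finite_subset[of _ "Pow {1..r}"]) (auto simp: \<Delta>_def)
  have fin_F: "finite F" if "F \<in> \<Delta>" for F
    using that finite_subset[of F "{1..r}"] by (auto simp: \<Delta>_def)
  have length: "module_length Rees (quot_module Rees (frobenius_power Rees gens s)) =
      enat (\<Sum>F\<in>\<Delta>. card (survivors F s))" if s: "1 \<le> s" for s
  proof -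
    \<comment> \<open>\<open>g 0 i\<close> and \<open>g 1 i\<close> are the exponents of \<open>x\<^sub>i\<^sup>s\<close> and \<open>x\<^sub>i\<^sup>s t\<^sup>s\<close>.\<close>
    define g where "g e i = (single i s, s * e)" for e i :: nat
    let ?G = "(\<lambda>(e, i). g e i) ` ({0, 1} \<times> W)"
    let ?U = "{\<beta>. \<exists>g\<in>?G. \<exists>\<beta>'\<in>R.rees_basis. \<beta> = g + \<beta>'}"
    have G: "?G \<subseteq> R.rees_basis"
      using single_W by (auto simp: R.rees_basis_def g_def)
    have pow_W: "up_ring.monom (UP R) (x i) e [^]\<^bsub>Rees\<^esub> s = R.rees_mon (g e i) 1"
      if "i \<in> W" "e \<in> {0, 1}" for e i
    proof -
      let ?f = "\<lambda>n. (single i n, n * e)"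
      have "R.rees_mon (?f 1) 1 [^]\<^bsub>Rees\<^esub> s = R.rees_mon (?f s) 1"
      proof (rule A.mon_pow)
        show "?f n \<in> R.rees_basis" for n
          using single_W[OF that(1)] that(2) by (auto simp: R.rees_basis_def)
      qed (auto simp: zero_prod_def simp flip: single_add)
      then show ?thesis by (simp add: R.rees_mon_def x_W g_def)
    qed
    \<comment> \<open>Here \<open>s \<ge> 1\<close> matters, as the zeroth power of zero is one.\<close>
    have pow_not_W: "up_ring.monom (UP R) (x i) e [^]\<^bsub>Rees\<^esub> s = \<zero>\<^bsub>Rees\<^esub>"
      if "i \<in> {1..r}" "i \<notin> W" for e i
    proof -
      have "up_ring.monom (UP R) (x i) e = \<zero>\<^bsub>Rees\<^esub>"
        using x_not_W[OF that] by (simp add: Rees_eq R.rees_algebra_eq)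
      then show ?thesis using s by (simp add: A.nat_pow_zero)
    qed
    let ?H = "(\<lambda>g. g [^]\<^bsub>Rees\<^esub> s) ` gens"
    have gens_eq: "gens = (\<lambda>(e, i). up_ring.monom (UP R) (x i) e) ` ({0, 1} \<times> {1..r})"
      unfolding gens by auto
    have H1: "(\<lambda>\<beta>. R.rees_mon \<beta> 1) ` ?G \<subseteq> ?H"
    proof
      fix h assume "h \<in> (\<lambda>\<beta>. R.rees_mon \<beta> 1) ` ?G"
      then obtain \<beta> where \<beta>: "h = R.rees_mon \<beta> 1" "\<beta> \<in> ?G" by (rule imageE)
      from \<beta>(2) obtain e i where "e \<in> {0, 1}" "i \<in> W" "\<beta> = g e i" by auto
      with \<beta>(1) have ei: "e \<in> {0, 1}" "i \<in> W" "h = R.rees_mon (g e i) 1" by simp_all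
      then have "(e, i) \<in> {0, 1} \<times> {1..r}" by (auto simp: W_def)
      then have "up_ring.monom (UP R) (x i) e \<in> gens" unfolding gens_eq by (rule rev_image_eqI) simp
      then show "h \<in> ?H" using pow_W[OF ei(2,1)] ei(3) by (metis imageI)
    qed
    have H2: "?H \<subseteq> insert \<zero>\<^bsub>Rees\<^esub> ((\<lambda>\<beta>. R.rees_mon \<beta> 1) ` ?G)"
    proof
      fix h assume "h \<in> ?H"
      then obtain p where p: "h = p [^]\<^bsub>Rees\<^esub> s" "p \<in> gens" by (rule imageE)
      from p(2) obtain \<epsilon> where "\<epsilon> \<in> {0, 1} \<times> {1..r}" "p = up_ring.monom (UP R) (x (snd \<epsilon>)) (fst \<epsilon>)"
        unfolding gens_eq case_prod_unfold by (rule imageE)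
      moreover define e i where "e = fst \<epsilon>" and "i = snd \<epsilon>"
      ultimately have "e \<in> {0, 1}" "i \<in> {1..r}" "p = up_ring.monom (UP R) (x i) e" by auto
      with p(1) have ei: "e \<in> {0, 1}" "i \<in> {1..r}" "h = up_ring.monom (UP R) (x i) e [^]\<^bsub>Rees\<^esub> s"
        by simp_all
      show "h \<in> insert \<zero>\<^bsub>Rees\<^esub> ((\<lambda>\<beta>. R.rees_mon \<beta> 1) ` ?G)"
      proof (cases "i \<in> W")
        case True
        then have "(e, i) \<in> {0, 1} \<times> W" using ei by blast
        then have "g e i \<in> ?G" by (rule rev_image_eqI) simp
        then show ?thesis using pow_W[OF True ei(1)] ei by blast
      qed (use pow_not_W ei in auto)
    qed
    have frob: "frobenius_power Rees gens s = A.mono_ideal ?U"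
      unfolding frobenius_power_def by (rule A.genideal_mon(1)[OF G H1 H2])
    have abs: "A.absorbing ?U" by (rule A.genideal_mon(2)[OF G H1 H2])
    have U: "(m, n) \<in> ?U \<longleftrightarrow> (\<exists>i\<in>keys m. s \<le> lookup m i \<and> (n + s \<le> total_degree m \<or> s \<le> n))"
      if mn: "m \<in> B - T" "n \<le> total_degree m" for m n
    proof
      assume "(m, n) \<in> ?U"
      then obtain \<gamma> m' n' where \<gamma>: "\<gamma> \<in> ?G" "(m, n) = \<gamma> + (m', n')" "n' \<le> total_degree m'"
        unfolding R.rees_basis_def by blast
      from \<gamma>(1) obtain \<epsilon> where "\<epsilon> \<in> {0, 1} \<times> W" "\<gamma> = g (fst \<epsilon>) (snd \<epsilon>)"
        unfolding case_prod_unfold by (rule imageE)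
      moreover define e i where "e = fst \<epsilon>" and "i = snd \<epsilon>"
      ultimately have ei: "e \<in> {0, 1}" "m = single i s + m'" "n = s * e + n'"
        using \<gamma>(2) by (auto simp: g_def)
      then have "i \<in> keys m" "s \<le> lookup m i" "n + s \<le> total_degree m \<or> s \<le> n"
        using s \<gamma>(3) by (auto simp: total_degree_add keys_add_nat lookup_add)
      then show "\<exists>i\<in>keys m. s \<le> lookup m i \<and> (n + s \<le> total_degree m \<or> s \<le> n)" by blast
    next
      assume "\<exists>i\<in>keys m. s \<le> lookup m i \<and> (n + s \<le> total_degree m \<or> s \<le> n)"
      then obtain i where i: "i \<in> keys m" "s \<le> lookup m i" "n + s \<le> total_degree m \<or> s \<le> n" by blast
      \<comment> \<open>Divide by \<open>x\<^sub>i\<^sup>s\<close> if the degree left over still bounds the exponent of \<open>t\<close>, and by \<open>x\<^sub>i\<^sup>s t\<^sup>s\<close> otherwise.\<close>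
      define e :: nat where "e = (if n + s \<le> total_degree m then 0 else 1)"
      have "single i 1 \<in> B - T" by (rule sub[OF mn(1)]) (use i in simp)
      then have "i \<in> W" using i mn(1) by (auto simp: W_def B_def)
      have "(m, n) = g e i + (m - single i s, n - s * e)"
        using diff_single_add[OF i(2)] i(3) by (auto simp: g_def e_def add.commute)
      moreover have "(m - single i s, n - s * e) \<in> R.rees_basis"
        using sub[OF mn(1) keys_diff_nat] total_degree_diff_single[OF i(2)] mn(2)
        by (auto simp: R.rees_basis_def e_def)
      moreover have "g e i \<in> ?G" using \<open>i \<in> W\<close> by (intro image_eqI[of _ _ "(e, i)"]) (auto simp: e_def)
      ultimately show "(m, n) \<in> ?U" by blast
    qed
    have basis: "R.rees_basis - ?U = (\<Union>F\<in>\<Delta>. survivors F s)"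
    proof (rule Set.set_eqI)
      fix \<beta> :: "(nat \<Rightarrow>\<^sub>0 nat) \<times> nat"
      obtain m n where \<beta>: "\<beta> = (m, n)" by fastforce
      have "\<beta> \<in> R.rees_basis - ?U \<longleftrightarrow> keys m \<in> \<Delta> \<and> n \<le> total_degree m \<and> (m, n) \<notin> ?U"
        unfolding \<beta> R.rees_basis_def using \<Delta>[of m] by blast
      also have "\<dots> \<longleftrightarrow> keys m \<in> \<Delta> \<and> (m, n) \<in> survivors (keys m) s"
      proof -
        have "(m, n) \<notin> ?U \<longleftrightarrow> (\<forall>i\<in>keys m. lookup m i < s \<or> total_degree m < n + s \<and> n < s)"
          if "keys m \<in> \<Delta>" "n \<le> total_degree m"
          unfolding U[OF \<Delta>[THEN iffD2, OF that(1)] that(2)] by (auto simp: not_le)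
        then show ?thesis unfolding survivors_def by blast
      qed
      also have "\<dots> \<longleftrightarrow> \<beta> \<in> (\<Union>F\<in>\<Delta>. survivors F s)"
        by (auto simp: survivors_def \<beta>)
      finally show "\<beta> \<in> R.rees_basis - ?U \<longleftrightarrow> \<beta> \<in> (\<Union>F\<in>\<Delta>. survivors F s)" .
    qed
    have fin: "finite (R.rees_basis - ?U)"
      unfolding basis using fin_\<Delta> fin_F card_survivors(1) s by blast
    have card: "card (R.rees_basis - ?U) = (\<Sum>F\<in>\<Delta>. card (survivors F s))"
      unfolding basis using fin_\<Delta> fin_F card_survivors(1) s
      by (intro card_UN_disjoint) (auto simp: survivors_def)
    have "module_length Rees (quot_module Rees (A.mono_ideal ?U)) = enat (card (R.rees_basis - ?U))"
    proof (rule A.module_length_quot_mono_ideal[where deg = "\<lambda>\<beta>. total_degree (fst \<beta>)"])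
      have "0 \<notin> keys (0 :: nat \<Rightarrow>\<^sub>0 nat)" by simp
      then show "0 \<notin> ?U" using U[of 0 0] T0 by (simp add: B_def zero_prod_def)
      show "A.absorbing ?U" by (rule abs)
      show "finite (R.rees_basis - ?U)" by (rule fin)
    qed (auto simp: total_degree_add total_degree_eq_0_iff R.rees_basis_def zero_prod_def)
    then show ?thesis by (simp only: frob card)
  qed
  have "\<forall>F\<in>\<Delta>. \<exists>Q :: rat poly. \<forall>s\<ge>1. of_nat (card (survivors F s)) = poly Q (of_nat s)"
    using poly_card_survivors fin_F by blast
  then obtain Q :: "nat set \<Rightarrow> rat poly" where
    Q: "\<forall>F\<in>\<Delta>. \<forall>s\<ge>1. of_nat (card (survivors F s)) = poly (Q F) (of_nat s)" by metis
  show ?thesis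
  proof (intro exI[of _ "\<Sum>F\<in>\<Delta>. Q F"] allI impI)
    fix s assume "\<delta> < s"
    then have s: "1 \<le> s" by simp
    have "of_nat (\<Sum>F\<in>\<Delta>. card (survivors F s)) = poly (\<Sum>F\<in>\<Delta>. Q F) (of_nat s)"
      using Q s by (simp add: poly_sum)
    then show "\<exists>N. module_length Rees (quot_module Rees (frobenius_power Rees gens s)) = enat N \<and>
        of_nat N = poly (\<Sum>F\<in>\<Delta>. Q F) (of_nat s)"
      using length[OF s] by blast
  qed
qed

end
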